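(* Let $1\le r\le N$ be integers. If $X$ is a closed subscheme of $S_r(N)$ and $X$ does not intersect $S_{r-1}(N)$, then $\dim X \le N-r$.
   Context: Schemes are of finite type over $\mathbb{C}$. $S_r(N)$ denotes the projectivized variety of symmetric $N\times N$ complex matrices of rank at most $r$, i.e. the closed subvariety of the projective space of lines in the vector space of symmetric $N\times N$ complex matrices consisting of the classes of nonzero matrices of rank at most $r$. In particular $S_0(N)=\emptyset$. *)

theory Defs
  imports
    "HOL-Analysis.Analysis"
    "HOL-Library.Poly_Mapping"
    "HOL-Library.Uprod"
    "HOL-Algebra.Algebraic_Closure_Type"
begin

section \<open>The homogeneous coordinate ring of the projective space of symmetric matrices\<close>

text \<open>
  The index type \<open>'n\<close> plays the role of \<open>{1..N}\<close>, so \<open>N = CARD('n) \<ge> 1\<close>. There is one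
  variable for every unordered pair of indices, standing for the matrix entry
  \<open>A $ i $ j = A $ j $ i\<close>.
\<close>

type_synonym 'n sym_poly = "('n uprod \<Rightarrow>\<^sub>0 nat) \<Rightarrow>\<^sub>0 complex"

abbreviation sym_poly_ring :: "'n sym_poly ring"
  where "sym_poly_ring \<equiv> ring_of_type_algebra"

text \<open>The description picks a unique value only if \<open>A\<close> is symmetric.\<close>

definition sym_entry :: "complex^'n^'n \<Rightarrow> 'n uprod \<Rightarrow> complex"
  where "sym_entry A u = (THE c. \<exists>i j. u = Upair i j \<and> c = A $ i $ j)"

lemma sym_entry_Upair:
  assumes "transpose A = A"
  shows "sym_entry A (Upair i j) = A $ i $ j"
proof -
  have "A $ k $ l = A $ l $ k" for k l
    using assms by (metis transpose_def vec_lambda_beta)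
  then show ?thesis
    unfolding sym_entry_def by (intro the_equality) auto
qed

definition sym_eval :: "'n sym_poly \<Rightarrow> complex^'n^'n \<Rightarrow> complex" where
  "sym_eval f A =
     (\<Sum>m\<in>Poly_Mapping.keys f. Poly_Mapping.lookup f m *
        (\<Prod>u\<in>Poly_Mapping.keys m. sym_entry A u ^ Poly_Mapping.lookup m u))"

definition mon_deg :: "('v \<Rightarrow>\<^sub>0 nat) \<Rightarrow> nat"
  where "mon_deg m = (\<Sum>v\<in>Poly_Mapping.keys m. Poly_Mapping.lookup m v)"

definition homogeneous :: "nat \<Rightarrow> 'n sym_poly \<Rightarrow> bool"
  where "homogeneous d f \<longleftrightarrow> (\<forall>m\<in>Poly_Mapping.keys f. mon_deg m = d)"

definition homogeneous_ideal :: "'n sym_poly set \<Rightarrow> bool" where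
  "homogeneous_ideal J \<longleftrightarrow>
     ideal J sym_poly_ring \<and> J = genideal sym_poly_ring {f \<in> J. \<exists>d. homogeneous d f}"

definition irrelevant_ideal :: "'n sym_poly set"
  where "irrelevant_ideal = {f. Poly_Mapping.lookup f 0 = 0}"


section \<open>The projective space as the topological space underlying Proj\<close>

definition Proj_points :: "'n sym_poly set set" where
  "Proj_points =
     {p. primeideal p sym_poly_ring \<and> homogeneous_ideal p \<and> \<not> irrelevant_ideal \<subseteq> p}"

definition V_plus :: "'n sym_poly set \<Rightarrow> 'n sym_poly set set"
  where "V_plus J = {p \<in> Proj_points. J \<subseteq> p}"

definition Proj_top :: "'n sym_poly set topology" where
  "Proj_top = topology (\<lambda>U. \<exists>J. homogeneous_ideal J \<and> U = Proj_points - V_plus J)"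

lemma ideal_genideal: "ideal (genideal sym_poly_ring E) sym_poly_ring"
  by (rule ring.genideal_ideal) (auto simp: ring_of_type_algebra_def ring_from_type_algebra[unfolded ring_of_type_algebra_def])

lemma genideal_subset: "E \<subseteq> genideal sym_poly_ring E"
  unfolding genideal_def by auto

lemma genideal_least: "ideal J sym_poly_ring \<Longrightarrow> E \<subseteq> J \<Longrightarrow> genideal sym_poly_ring E \<subseteq> J"
  unfolding genideal_def by auto

lemma homogeneous_genideal:
  assumes "\<And>f. f \<in> E \<Longrightarrow> \<exists>d. homogeneous d f"
  shows "homogeneous_ideal (genideal sym_poly_ring E)"
proof -
  let ?J = "genideal sym_poly_ring E"
  have "E \<subseteq> {f \<in> ?J. \<exists>d. homogeneous d f}"
    using assms genideal_subset by blast
  then have "?J \<subseteq> genideal sym_poly_ring {f \<in> ?J. \<exists>d. homogeneous d f}"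
    by (meson genideal_least genideal_subset ideal_genideal subset_trans)
  moreover have "genideal sym_poly_ring {f \<in> ?J. \<exists>d. homogeneous d f} \<subseteq> ?J"
    by (intro genideal_least ideal_genideal) auto
  ultimately show ?thesis
    unfolding homogeneous_ideal_def using ideal_genideal by blast
qed

lemma V_plus_genideal: "V_plus (genideal sym_poly_ring E) = {p \<in> Proj_points. E \<subseteq> p}"
  unfolding V_plus_def Proj_points_def homogeneous_ideal_def
  using genideal_subset genideal_least by blast

lemma V_plus_homogeneous:
  assumes "homogeneous_ideal J"
  shows "V_plus J = {p \<in> Proj_points. {f \<in> J. \<exists>d. homogeneous d f} \<subseteq> p}"
  using assms V_plus_genideal unfolding homogeneous_ideal_def by metis

lemma mon_deg_add: "mon_deg (a + b) = mon_deg a + mon_deg b"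
proof -
  have *: "mon_deg m = (\<Sum>v\<in>S. Poly_Mapping.lookup m v)"
    if "finite S" "Poly_Mapping.keys m \<subseteq> S" for m :: "'a \<Rightarrow>\<^sub>0 nat" and S
    unfolding mon_deg_def using that
    by (intro sum.mono_neutral_left) (auto simp: in_keys_iff)
  let ?S = "Poly_Mapping.keys a \<union> Poly_Mapping.keys b"
  have "Poly_Mapping.keys (a + b) \<subseteq> ?S"
    by (rule Poly_Mapping.keys_add)
  then show ?thesis
    by (simp add: *[of ?S] lookup_add sum.distrib)
qed

lemma homogeneous_mult:
  assumes "homogeneous d f" "homogeneous e g"
  shows "homogeneous (d + e) (f * g)"
  using assms keys_mult[of f g] unfolding homogeneous_def by (force simp: mon_deg_add)

lemma istopology_Proj:
  "istopology (\<lambda>U. \<exists>J :: 'n sym_poly set. homogeneous_ideal J \<and> U = Proj_points - V_plus J)"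
  unfolding istopology_def
proof (intro conjI allI impI)
  fix U W :: "'n sym_poly set set"
  assume "\<exists>J. homogeneous_ideal J \<and> U = Proj_points - V_plus J"
  then obtain J where J: "homogeneous_ideal J" "U = Proj_points - V_plus J" by blast
  assume "\<exists>J. homogeneous_ideal J \<and> W = Proj_points - V_plus J"
  then obtain K where K: "homogeneous_ideal K" "W = Proj_points - V_plus K" by blast
  let ?E = "{f * g |f g. f \<in> J \<and> g \<in> K \<and> (\<exists>d. homogeneous d f) \<and> (\<exists>d. homogeneous d g)}"
  have "?E \<subseteq> p \<longleftrightarrow> {f \<in> J. \<exists>d. homogeneous d f} \<subseteq> p \<or> {f \<in> K. \<exists>d. homogeneous d f} \<subseteq> p"
    if "p \<in> Proj_points" for p
  proof
    interpret primeideal p sym_poly_ring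
      using that by (simp add: Proj_points_def)
    show "?E \<subseteq> p \<Longrightarrow> {f \<in> J. \<exists>d. homogeneous d f} \<subseteq> p \<or> {f \<in> K. \<exists>d. homogeneous d f} \<subseteq> p"
      using I_prime by (fastforce simp: ring_of_type_algebra_def)
    show "{f \<in> J. \<exists>d. homogeneous d f} \<subseteq> p \<or> {f \<in> K. \<exists>d. homogeneous d f} \<subseteq> p \<Longrightarrow> ?E \<subseteq> p"
    proof -
      have "f * g \<in> p" if "f \<in> p \<or> g \<in> p" for f g
        using that I_l_closed[of g f] I_r_closed[of f g] by (auto simp: ring_of_type_algebra_def)
      then show "{f \<in> J. \<exists>d. homogeneous d f} \<subseteq> p \<or> {f \<in> K. \<exists>d. homogeneous d f} \<subseteq> p \<Longrightarrow> ?E \<subseteq> p"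
        by blast
    qed
  qed
  then have "U \<inter> W = Proj_points - V_plus (genideal sym_poly_ring ?E)"
    unfolding J K V_plus_homogeneous[OF J(1)] V_plus_homogeneous[OF K(1)] V_plus_genideal
    by blast
  moreover have "homogeneous_ideal (genideal sym_poly_ring ?E)"
    by (intro homogeneous_genideal) (use homogeneous_mult in blast)
  ultimately show "\<exists>J. homogeneous_ideal J \<and> U \<inter> W = Proj_points - V_plus J" by blast
next
  fix \<U> :: "'n sym_poly set set set"
  assume "\<forall>U\<in>\<U>. \<exists>J. homogeneous_ideal J \<and> U = Proj_points - V_plus J"
  then obtain J where J: "\<And>U. U \<in> \<U> \<Longrightarrow> homogeneous_ideal (J U)"
    "\<And>U. U \<in> \<U> \<Longrightarrow> U = Proj_points - V_plus (J U)"
    by metis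
  let ?E = "\<Union>U\<in>\<U>. {f \<in> J U. \<exists>d. homogeneous d f}"
  have "U = Proj_points - {p \<in> Proj_points. {f \<in> J U. \<exists>d. homogeneous d f} \<subseteq> p}"
    if "U \<in> \<U>" for U
    using J(2)[OF that] V_plus_homogeneous[OF J(1)[OF that]] by simp
  then have "\<Union>\<U> = (\<Union>U\<in>\<U>. Proj_points - {p \<in> Proj_points. {f \<in> J U. \<exists>d. homogeneous d f} \<subseteq> p})"
    by (simp cong: SUP_cong)
  also have "\<dots> = Proj_points - V_plus (genideal sym_poly_ring ?E)"
    unfolding V_plus_genideal by blast
  finally have "\<Union>\<U> = Proj_points - V_plus (genideal sym_poly_ring ?E)" .
  moreover have "homogeneous_ideal (genideal sym_poly_ring ?E)"
    by (intro homogeneous_genideal) blast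
  ultimately show "\<exists>J. homogeneous_ideal J \<and> \<Union>\<U> = Proj_points - V_plus J" by blast
qed

lemma openin_Proj_top:
  "openin Proj_top U \<longleftrightarrow> (\<exists>J. homogeneous_ideal J \<and> U = Proj_points - V_plus J)"
  unfolding Proj_top_def topology_inverse'[OF istopology_Proj] ..


section \<open>Krull dimension of a topological space\<close>

definition irreducible_closed :: "'a topology \<Rightarrow> 'a set \<Rightarrow> bool" where
  "irreducible_closed T Z \<longleftrightarrow> closedin T Z \<and> Z \<noteq> {} \<and>
     (\<forall>A B. closedin T A \<and> closedin T B \<and> Z = A \<union> B \<longrightarrow> Z = A \<or> Z = B)"

text \<open>The empty space has dimension \<open>-\<infinity>\<close>, the supremum of the empty set.\<close>

definition krull_dim :: "'a topology \<Rightarrow> ereal" where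
  "krull_dim T = (SUP n \<in> {n :: nat. \<exists>Z :: nat \<Rightarrow> 'a set.
      (\<forall>i\<le>n. irreducible_closed T (Z i)) \<and> (\<forall>i<n. Z i \<subset> Z (Suc i))}. ereal (real n))"


section \<open>The varieties of symmetric matrices of bounded rank\<close>

definition sym_rank_le :: "nat \<Rightarrow> (complex^'n^'n) set"
  where "sym_rank_le r = {A. transpose A = A \<and> A \<noteq> 0 \<and> rank A \<le> r}"

text \<open>
  The ideal of the reduced closed subscheme \<open>S_r(N)\<close>. It is homogeneous because
  \<^term>\<open>sym_rank_le r\<close> is stable under nonzero scalars, and it is the whole ring for \<open>r = 0\<close>.
\<close>

definition S_ideal :: "nat \<Rightarrow> 'n::finite sym_poly set"
  where "S_ideal r = {f. \<forall>A \<in> sym_rank_le r. sym_eval f A = 0}"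

text \<open>
  A homogeneous ideal \<open>I\<close> of a graded ring \<open>R\<close> defines the closed subscheme \<open>Proj (R/I)\<close> of
  \<open>Proj R\<close>, whose underlying space is \<^term>\<open>V_plus I\<close>. Every closed subscheme of
  \<open>S_r(N) = Proj (R / S_ideal r)\<close> arises from a homogeneous ideal containing
  \<^term>\<open>S_ideal r\<close>; different ideals may define the same subscheme.
\<close>

definition closed_subscheme_S :: "nat \<Rightarrow> 'n::finite sym_poly set \<Rightarrow> bool"
  where "closed_subscheme_S r I \<longleftrightarrow> homogeneous_ideal I \<and> S_ideal r \<subseteq> I"

definition scheme_dim :: "'n sym_poly set \<Rightarrow> ereal"
  where "scheme_dim I = krull_dim (subtopology Proj_top (V_plus I))"

end

theory Submission
  imports Defs
begin

text \<open>
  Why the bound holds. Let \<open>A\<close> be the generic point of the cone over an irreducible \<open>X\<close>, a symmetric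
  matrix of rank \<open>r\<close>, let \<open>x\<close> be a generic vector, and put \<open>c = x\<^sup>T A x\<close>, \<open>u = A x\<close> and \<open>B = c A\<close>.
  By Lagrange's reduction of quadratic forms, \<open>B - u u\<^sup>T\<close> kills \<open>x\<close> and has rank one less than
  \<open>A\<close>, hence every form that vanishes on \<open>S\<^bsub>r-1\<^esub>(N)\<close> vanishes at \<open>B - u u\<^sup>T\<close>, whereas the ideal of \<open>X\<close>
  vanishes at \<open>B\<close>. So at a limit point with \<open>u = 0\<close> the matrix \<open>B\<close> would be a point of the cone over
  \<open>X\<close> that has rank at most \<open>r - 1\<close>, which forces \<open>B = 0\<close>: the entries of \<open>B\<close> are integral over
  \<open>\<complex>[u\<^sub>1, \<dots>, u\<^sub>N]\<close>, and \<open>\<complex>[u, B]\<close> has dimension at most \<open>N\<close>. On the other hand \<open>B\<close> determines the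
  point \<open>[A]\<close> of \<open>X\<close>, and for given \<open>A\<close> the vector \<open>u\<close> ranges over the image of \<open>A\<close>, of dimension \<open>r\<close>.
  So \<open>\<complex>[u, B]\<close> has dimension at least \<open>dim X + r\<close>, and \<open>dim X + r \<le> N\<close>.

  The two dimensions are compared by counting monomials of bounded degree modulo a homogeneous prime
  \<open>p\<close>, the ideal of the largest set of a chain of \<open>d + 1\<close> irreducible closed sets.

  \<^item> Integrality is explicit. Disjointness from \<open>S\<^bsub>r-1\<^esub>(N)\<close> means that every variable has a power
    \<open>Var e ^ n\<close> congruent modulo the ideal of \<open>X\<close> to a form \<open>j\<close> vanishing on \<open>S\<^bsub>r-1\<^esub>(N)\<close>
    (\<open>ex_power_in_sum\<close>). Since \<open>j(B - u u\<^sup>T)\<close> is zero modulo \<open>p\<close> (\<open>subst_Lagrange_curve_in_S_ideal\<close>),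
    the \<open>n\<close>-th power of an entry of \<open>B\<close> equals \<open>j(B) - j(B - u u\<^sup>T)\<close>, a sum of terms of lower degree in \<open>B\<close>
    (\<open>subst_diff_in_lower\<close>). So the part of weight at most \<open>t\<close> is spanned by \<open>O(t\<^sup>N)\<close> monomials, and
    more elements than that satisfy a linear relation (\<open>ex_relation_in_fil\<close>).
  \<^item> A chain of \<open>d + 1\<close> primes yields \<open>d\<close> forms that separate consecutive primes and one form outside all of
    them; their monomials of a fixed degree are linearly independent (\<open>radix_independent\<close>). By \<open>r\<close>
    steps of Lagrange's reduction one obtains \<open>r\<close> independent combinations of the \<open>u\<^sub>i\<close>
    (\<open>ex_pivots\<close>). Together they give \<open>m\<^bsup>d + r\<^esup>\<close> independent elements of weight \<open>O(m)\<close>.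
  \<^item> The vector \<open>x\<close> is not given independent variables as coordinates, but runs through a curve
    \<open>\<Sum>i. \<tau> ^ (m ^ i) * x\<^sub>i\<close> in one variable \<open>\<tau>\<close>. This is Kronecker's substitution: a monomial with exponents below \<open>m\<close>
    is recognized by its degree in \<open>\<tau>\<close>, so that univariate polynomials suffice.
\<close>

hide_const (open) up_ring.coeff up_ring.monom Polynomials.degree Polynomials.lead_coeff


section \<open>Ideals and primes of a commutative ring\<close>

definition is_ideal :: "'a::comm_ring_1 set \<Rightarrow> bool" where
  "is_ideal J \<longleftrightarrow> 0 \<in> J \<and> (\<forall>x\<in>J. \<forall>y\<in>J. x + y \<in> J) \<and> (\<forall>x. \<forall>y\<in>J. x * y \<in> J)"

definition is_prime :: "'a::comm_ring_1 set \<Rightarrow> bool" where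
  "is_prime p \<longleftrightarrow> is_ideal p \<and> 1 \<notin> p \<and> (\<forall>x y. x * y \<in> p \<longrightarrow> x \<in> p \<or> y \<in> p)"

lemma is_idealD:
  assumes "is_ideal J"
  shows "0 \<in> J" "x \<in> J \<Longrightarrow> y \<in> J \<Longrightarrow> x + y \<in> J" "y \<in> J \<Longrightarrow> x * y \<in> J"
    "y \<in> J \<Longrightarrow> y * x \<in> J" "x \<in> J \<Longrightarrow> - x \<in> J" "x \<in> J \<Longrightarrow> y \<in> J \<Longrightarrow> x - y \<in> J"
proof -
  show *: "0 \<in> J" "x \<in> J \<Longrightarrow> y \<in> J \<Longrightarrow> x + y \<in> J" "y \<in> J \<Longrightarrow> x * y \<in> J" for x y
    using assms by (auto simp: is_ideal_def)
  show "y \<in> J \<Longrightarrow> y * x \<in> J" using *(3)[of y x] by (simp add: mult.commute)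
  show m: "x \<in> J \<Longrightarrow> - x \<in> J" for x using *(3)[of x "-1"] by simp
  show "x \<in> J \<Longrightarrow> y \<in> J \<Longrightarrow> x - y \<in> J" using *(2)[of x "- y"] m[of y] by simp
qed

lemma is_ideal_sum: "is_ideal J \<Longrightarrow> (\<And>i. i \<in> A \<Longrightarrow> f i \<in> J) \<Longrightarrow> sum f A \<in> J"
  by (induction A rule: infinite_finite_induct) (auto intro: is_idealD)

lemma is_ideal_add_iff:
  "is_ideal J \<Longrightarrow> x \<in> J \<Longrightarrow> x + y \<in> J \<longleftrightarrow> y \<in> J"
  "is_ideal J \<Longrightarrow> y \<in> J \<Longrightarrow> x + y \<in> J \<longleftrightarrow> x \<in> J"
  by (metis add_diff_cancel_left' is_idealD(2,6), metis add_diff_cancel_right' is_idealD(2,6))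

lemma is_primeD:
  assumes "is_prime p"
  shows "is_ideal p" "1 \<notin> p" "x * y \<in> p \<longleftrightarrow> x \<in> p \<or> y \<in> p"
  using assms is_idealD(3,4)[of p] unfolding is_prime_def by blast+

lemma is_prime_power: "is_prime p \<Longrightarrow> x ^ n \<in> p \<Longrightarrow> x \<in> p"
  by (induction n) (auto simp: is_primeD)

lemma cong_mult:
  assumes "is_ideal q" "x - x' \<in> q" "y - y' \<in> q"
  shows "x * y - x' * y' \<in> q"
proof -
  have "x * y - x' * y' = (x - x') * y + x' * (y - y')" by (simp add: algebra_simps)
  then show ?thesis using assms by (simp add: is_idealD)
qed

lemma cong_power: "is_ideal q \<Longrightarrow> x - x' \<in> q \<Longrightarrow> x ^ n - x' ^ n \<in> q"
  by (induction n) (auto intro: cong_mult is_idealD)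

lemma cong_prod:
  assumes "is_ideal q" "\<And>i. i \<in> A \<Longrightarrow> f i - g i \<in> q"
  shows "prod f A - prod g A \<in> q"
  using assms(2)
  by (induction A rule: infinite_finite_induct) (auto intro!: cong_mult assms(1) simp: is_idealD(1)[OF assms(1)])

lemma is_ideal_iff: "ideal J (ring_of_type_algebra :: 'a::comm_ring_1 ring) \<longleftrightarrow> is_ideal J"
proof
  assume "ideal J (ring_of_type_algebra :: 'a ring)"
  then interpret ideal J "ring_of_type_algebra :: 'a ring" .
  show "is_ideal J"
    unfolding is_ideal_def
  proof (intro conjI ballI allI)
    show "0 \<in> J" using additive_subgroup.zero_closed[OF is_additive_subgroup]
      by (simp add: ring_of_type_algebra_def)
    show "x + y \<in> J" if "x \<in> J" "y \<in> J" for x y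
      using additive_subgroup.a_closed[OF is_additive_subgroup that] by (simp add: ring_of_type_algebra_def)
    show "x * y \<in> J" if "y \<in> J" for x y
      using I_l_closed[OF that, of x] by (simp add: ring_of_type_algebra_def)
  qed
next
  assume *: "is_ideal J"
  let ?R = "ring_of_type_algebra :: 'a ring"
  have R: "ring ?R" by (rule ring_from_type_algebra)
  interpret ring ?R by (rule R)
  have neg: "\<ominus>\<^bsub>?R\<^esub> x = - x" for x
    by (rule minus_equality) (auto simp: ring_of_type_algebra_def)
  show "ideal J ?R"
  proof (rule idealI[OF R])
    show "subgroup J (add_monoid ?R)"
      using * neg by unfold_locales
        (auto simp: ring_of_type_algebra_def is_idealD a_inv_def)
  qed (auto simp: ring_of_type_algebra_def is_idealD[OF *])
qed

lemma is_prime_iff: "primeideal p (ring_of_type_algebra :: 'a::comm_ring_1 ring) \<longleftrightarrow> is_prime p"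
proof
  assume "primeideal p (ring_of_type_algebra :: 'a ring)"
  then interpret primeideal p "ring_of_type_algebra :: 'a ring" .
  have "is_ideal p" using is_ideal_iff ideal_axioms by blast
  moreover have "1 \<notin> p"
    using I_notcarr one_imp_carrier by (auto simp: ring_of_type_algebra_def)
  ultimately show "is_prime p"
    using I_prime unfolding is_prime_def by (simp add: ring_of_type_algebra_def)
next
  assume *: "is_prime p"
  have "cring (ring_of_type_algebra :: 'a ring)" by (rule cring_from_type_algebra)
  then show "primeideal p (ring_of_type_algebra :: 'a ring)"
    using is_primeD[OF *] is_ideal_iff[of p]
    by (intro primeidealI) (auto simp: ring_of_type_algebra_def)
qed

text \<open>The usual Zorn argument: an ideal maximal among those that avoid the powers of an element is
  prime.\<close>

lemma ex_prime_avoiding: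
  fixes J :: "'a::comm_ring_1 set"
  assumes J: "is_ideal J" and a: "\<And>n. a ^ n \<notin> J"
  obtains p where "is_prime p" "J \<subseteq> p" "a \<notin> p"
proof -
  let ?A = "{K. is_ideal K \<and> J \<subseteq> K \<and> (\<forall>n. a ^ n \<notin> K)}"
  have "\<exists>M\<in>?A. \<forall>L\<in>?A. M \<subseteq> L \<longrightarrow> L = M"
  proof (rule subset_Zorn_nonempty)
    show "?A \<noteq> {}" using J a by blast
    fix \<C> assume "\<C> \<noteq> {}" and ch: "subset.chain ?A \<C>"
    then have sub: "\<C> \<subseteq> ?A" and tot: "\<And>L L'. L \<in> \<C> \<Longrightarrow> L' \<in> \<C> \<Longrightarrow> L \<subseteq> L' \<or> L' \<subseteq> L"
      by (auto simp: subset_chain_def)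
    have "is_ideal (\<Union>\<C>)"
      unfolding is_ideal_def
    proof (intro conjI ballI allI)
      show "0 \<in> \<Union>\<C>" using \<open>\<C> \<noteq> {}\<close> sub is_idealD(1) by fastforce
      fix x y assume "x \<in> \<Union>\<C>" "y \<in> \<Union>\<C>"
      then obtain L L' where "L \<in> \<C>" "x \<in> L" "L' \<in> \<C>" "y \<in> L'" by blast
      then obtain L'' where "L'' \<in> \<C>" "x \<in> L''" "y \<in> L''" using tot by blast
      then show "x + y \<in> \<Union>\<C>" using sub is_idealD(2) by blast
    next
      fix x y assume "y \<in> \<Union>\<C>"
      then show "x * y \<in> \<Union>\<C>" using sub is_idealD(3) by blast
    qed
    then show "\<Union>\<C> \<in> ?A" using sub \<open>\<C> \<noteq> {}\<close> by blast
  qed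
  then obtain p where pA: "p \<in> ?A" and pmax: "\<forall>L\<in>?A. p \<subseteq> L \<longrightarrow> L = p"
    by (rule bexE)
  then have p: "is_ideal p" "J \<subseteq> p" "\<And>n. a ^ n \<notin> p"
    and max: "\<And>L. is_ideal L \<Longrightarrow> J \<subseteq> L \<Longrightarrow> \<forall>n. a ^ n \<notin> L \<Longrightarrow> p \<subseteq> L \<Longrightarrow> L = p"
    by simp_all
  have ext: "\<exists>n. \<exists>u\<in>p. \<exists>s. a ^ n = u + s * x" if "x \<notin> p" for x
  proof -
    let ?E = "{u + s * x | u s. u \<in> p}"
    have "is_ideal ?E"
      unfolding is_ideal_def
    proof (intro conjI ballI allI)
      show "0 \<in> ?E" using is_idealD(1)[OF p(1)] by (intro CollectI exI[of _ 0]) auto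
      fix y z assume "y \<in> ?E" "z \<in> ?E"
      then obtain u s u' s' where "y = u + s * x" "z = u' + s' * x" "u \<in> p" "u' \<in> p" by blast
      then have "y + z = (u + u') + (s + s') * x" "u + u' \<in> p"
        using p(1) by (auto simp: algebra_simps is_idealD)
      then show "y + z \<in> ?E" by blast
    next
      fix t y assume "y \<in> ?E"
      then obtain u s where "y = u + s * x" "u \<in> p" by blast
      then have "t * y = t * u + (t * s) * x" "t * u \<in> p"
        using p(1) by (auto simp: algebra_simps is_idealD)
      then show "t * y \<in> ?E" by blast
    qed
    moreover have "p \<subseteq> ?E" by (force intro: exI[of _ 0])
    moreover have "x \<in> ?E" using is_idealD(1)[OF p(1)] by (intro CollectI exI[of _ 0] exI[of _ 1]) auto
    ultimately show ?thesis using max[of ?E] p(2) that by blast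
  qed
  have "is_prime p"
    unfolding is_prime_def
  proof (intro conjI allI impI p(1))
    show "1 \<notin> p" using p(3)[of 0] by simp
    fix x y assume xy: "x * y \<in> p"
    show "x \<in> p \<or> y \<in> p"
    proof (rule ccontr)
      assume "\<not> (x \<in> p \<or> y \<in> p)"
      then obtain n u s m v t where "u \<in> p" "v \<in> p" and e: "a ^ n = u + s * x" "a ^ m = v + t * y"
        using ext[of x] ext[of y] by blast
      have "a ^ (n + m) = u * (v + t * y) + (s * x) * v + (s * t) * (x * y)"
        by (simp add: power_add e algebra_simps)
      then have "a ^ (n + m) \<in> p"
        using p(1) \<open>u \<in> p\<close> \<open>v \<in> p\<close> xy by (metis is_idealD(2,3,4))
      then show False using p(3) by blast
    qed
  qed
  then show thesis using that p(2) p(3)[of 1] by simp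
qed


section \<open>Univariate polynomials modulo a prime\<close>

definition poly_ideal :: "'a::comm_ring_1 set \<Rightarrow> 'a poly set" where
  "poly_ideal J = {f. \<forall>n. coeff f n \<in> J}"

text \<open>The degree of the reduction of \<open>f\<close> modulo \<open>p\<close>.\<close>

definition lead_at :: "'a::comm_ring_1 set \<Rightarrow> 'a poly \<Rightarrow> nat \<Rightarrow> bool" where
  "lead_at p f n \<longleftrightarrow> coeff f n \<notin> p \<and> (\<forall>m>n. coeff f m \<in> p)"

lemma is_ideal_poly_ideal: "is_ideal J \<Longrightarrow> is_ideal (poly_ideal J)"
  by (subst is_ideal_def) (auto simp: poly_ideal_def coeff_mult is_idealD intro!: is_ideal_sum)

lemma ex_lead_at:
  assumes "is_ideal p" "f \<notin> poly_ideal p"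
  obtains n where "lead_at p f n"
proof -
  obtain k where k: "coeff f k \<notin> p" using assms by (auto simp: poly_ideal_def)
  let ?S = "{n. coeff f n \<notin> p}"
  have "?S \<subseteq> {..degree f}"
    using is_idealD(1)[OF assms(1)] by (auto simp: coeff_eq_0 intro: leI)
  then have fin: "finite ?S" by (rule finite_subset) simp
  have "lead_at p f (Max ?S)"
    unfolding lead_at_def using Max_in[OF fin] k Max_ge[OF fin] by (force simp: not_le[symmetric])
  then show thesis by (rule that)
qed

lemma lead_at_mult:
  assumes p: "is_prime p" and f: "lead_at p f n" and g: "lead_at p g k"
  shows "lead_at p (f * g) (n + k)"
  unfolding lead_at_def
proof (intro conjI allI impI)
  note I = is_primeD(1)[OF p]
  have rest: "coeff f i * coeff g (l - i) \<in> p" if "n + k \<le> l" "i \<le> l" "i \<noteq> n \<or> n + k < l" for i l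
  proof (cases "i > n")
    case True then show ?thesis using f I by (auto simp: lead_at_def is_idealD)
  next
    case False then have "l - i > k" using that by auto
    then show ?thesis using g I by (auto simp: lead_at_def is_idealD)
  qed
  have "coeff (f * g) (n + k) = coeff f n * coeff g k + (\<Sum>i\<in>{..n+k} - {n}. coeff f i * coeff g (n + k - i))"
    by (simp add: coeff_mult sum.remove[of "{..n+k}" n])
  moreover have "(\<Sum>i\<in>{..n+k} - {n}. coeff f i * coeff g (n + k - i)) \<in> p"
    by (intro is_ideal_sum I rest) auto
  moreover have "coeff f n * coeff g k \<notin> p"
    using f g by (auto simp: lead_at_def is_primeD[OF p])
  ultimately show "coeff (f * g) (n + k) \<notin> p" using I by (simp add: is_ideal_add_iff)
  show "coeff (f * g) l \<in> p" if "l > n + k" for l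
    unfolding coeff_mult by (intro is_ideal_sum I rest) (use that in auto)
qed

lemma lead_at_1: "is_prime p \<Longrightarrow> lead_at p 1 0"
  using is_primeD(2)[of p] is_idealD(1)[OF is_primeD(1), of p] by (auto simp: lead_at_def)

lemma lead_at_power: "is_prime p \<Longrightarrow> lead_at p f n \<Longrightarrow> lead_at p (f ^ k) (k * n)"
  by (induction k) (auto simp: lead_at_1 lead_at_mult)

lemma lead_at_const: "is_ideal p \<Longrightarrow> a \<notin> p \<Longrightarrow> lead_at p [:a:] 0"
  by (auto simp: lead_at_def is_idealD coeff_pCons split: nat.split)

lemma is_prime_poly_ideal:
  assumes p: "is_prime p" shows "is_prime (poly_ideal p)"
  unfolding is_prime_def
proof (intro conjI allI impI)
  note I = is_primeD(1)[OF p]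
  show "is_ideal (poly_ideal p)" by (rule is_ideal_poly_ideal[OF I])
  show "1 \<notin> poly_ideal p" using is_primeD(2)[OF p] by (auto simp: poly_ideal_def intro!: exI[of _ 0])
  fix f g assume fg: "f * g \<in> poly_ideal p"
  show "f \<in> poly_ideal p \<or> g \<in> poly_ideal p"
  proof (rule ccontr)
    assume "\<not> (f \<in> poly_ideal p \<or> g \<in> poly_ideal p)"
    then obtain n k where "lead_at p f n" "lead_at p g k"
      using ex_lead_at[OF I] by metis
    from lead_at_mult[OF p this] fg show False by (auto simp: lead_at_def poly_ideal_def)
  qed
qed

text \<open>Among the \<open>i\<close> with \<open>g i \<notin> p\<close> the largest would survive as the degree of the sum.\<close>

lemma coeffs_in_prime_if_distinct_leads:
  assumes p: "is_prime p" and F: "finite A"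
    and lead: "\<And>i. i \<in> A \<Longrightarrow> lead_at p (F i) i"
    and sum: "(\<Sum>i\<in>A. [:g i:] * F i) \<in> poly_ideal p"
  shows "\<forall>i\<in>A. g i \<in> p"
proof (rule ccontr)
  note I = is_primeD(1)[OF p]
  let ?S = "{i\<in>A. g i \<notin> p}"
  assume "\<not> ?thesis"
  then have ne: "?S \<noteq> {}" and fin: "finite ?S" using F by auto
  define n where "n = Max ?S"
  have n: "n \<in> A" "g n \<notin> p" using Max_in[OF fin ne] by (auto simp: n_def)
  have le: "i \<le> n" if "i \<in> A" "g i \<notin> p" for i using Max_ge[OF fin] that by (auto simp: n_def)
  have "coeff (\<Sum>i\<in>A. [:g i:] * F i) n = g n * coeff (F n) n + (\<Sum>i\<in>A-{n}. g i * coeff (F i) n)"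
    using n(1) F by (simp add: coeff_sum sum.remove[of A n])
  moreover have "(\<Sum>i\<in>A-{n}. g i * coeff (F i) n) \<in> p"
  proof (intro is_ideal_sum I)
    fix i assume i: "i \<in> A - {n}"
    show "g i * coeff (F i) n \<in> p"
    proof (cases "g i \<in> p")
      case False
      then have "coeff (F i) n \<in> p" using lead[of i] le[of i] i by (auto simp: lead_at_def)
      then show ?thesis using I by (simp add: is_idealD)
    qed (use I in \<open>simp add: is_idealD\<close>)
  qed
  moreover have "g n * coeff (F n) n \<notin> p"
    using n lead[of n] by (auto simp: is_primeD[OF p] lead_at_def)
  ultimately have "coeff (\<Sum>i\<in>A. [:g i:] * F i) n \<notin> p" using I by (simp add: is_ideal_add_iff)
  then show False using sum by (simp add: poly_ideal_def)
qed


section \<open>Substitution into multivariate polynomials\<close>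

definition ring_map :: "('a::comm_ring_1 \<Rightarrow> 'b::comm_ring_1) \<Rightarrow> bool" where
  "ring_map h \<longleftrightarrow> h 1 = 1 \<and> (\<forall>x y. h (x + y) = h x + h y) \<and> (\<forall>x y. h (x * y) = h x * h y)"

lemma ring_mapD:
  assumes "ring_map h"
  shows "h 1 = 1" "h (x + y) = h x + h y" "h (x * y) = h x * h y" "h 0 = 0"
    "h (- x) = - h x" "h (x - y) = h x - h y" "h (x ^ n) = h x ^ n"
proof -
  show *: "h 1 = 1" "h (x + y) = h x + h y" "h (x * y) = h x * h y" for x y
    using assms by (auto simp: ring_map_def)
  show z: "h 0 = 0" using *(2)[of 0 0] by simp
  show neg: "h (- x) = - h x" for x using *(2)[of x "- x"] z by (simp add: add_eq_0_iff)
  show "h (x - y) = h x - h y" using *(2)[of x "- y"] neg[of y] by simp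
  show "h (x ^ n) = h x ^ n" by (induction n) (auto simp: *)
qed

lemma ring_map_sum: "ring_map h \<Longrightarrow> h (sum f A) = (\<Sum>i\<in>A. h (f i))"
  by (induction A rule: infinite_finite_induct) (auto simp: ring_mapD)

lemma ring_map_prod: "ring_map h \<Longrightarrow> h (prod f A) = (\<Prod>i\<in>A. h (f i))"
  by (induction A rule: infinite_finite_induct) (auto simp: ring_mapD)

lemma is_ideal_vimage: "ring_map h \<Longrightarrow> is_ideal J \<Longrightarrow> is_ideal {x. h x \<in> J}"
  by (subst is_ideal_def) (auto simp: ring_mapD is_idealD)

lemma is_prime_vimage: "ring_map h \<Longrightarrow> is_prime p \<Longrightarrow> is_prime {x. h x \<in> p}"
  by (subst is_prime_def) (auto simp: is_ideal_vimage ring_mapD is_primeD)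

definition monom_eval :: "('v \<Rightarrow> 'b::comm_ring_1) \<Rightarrow> ('v \<Rightarrow>\<^sub>0 nat) \<Rightarrow> 'b" where
  "monom_eval v m = (\<Prod>x\<in>Poly_Mapping.keys m. v x ^ Poly_Mapping.lookup m x)"

text \<open>The coefficients are mapped by \<open>h\<close>, the variables are replaced by the values of \<open>v\<close>.\<close>

definition subst :: "(complex \<Rightarrow> 'b) \<Rightarrow> ('v \<Rightarrow> 'b::comm_ring_1) \<Rightarrow> (('v \<Rightarrow>\<^sub>0 nat) \<Rightarrow>\<^sub>0 complex) \<Rightarrow> 'b"
  where "subst h v f = (\<Sum>m\<in>Poly_Mapping.keys f. h (Poly_Mapping.lookup f m) * monom_eval v m)"

lemma monom_eval_superset:
  "finite S \<Longrightarrow> Poly_Mapping.keys m \<subseteq> S \<Longrightarrow> monom_eval v m = (\<Prod>x\<in>S. v x ^ Poly_Mapping.lookup m x)"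
  unfolding monom_eval_def by (intro prod.mono_neutral_left) (auto simp: in_keys_iff)

lemma monom_eval_0 [simp]: "monom_eval v 0 = 1"
  by (simp add: monom_eval_def)

lemma monom_eval_add: "monom_eval v (m + n) = monom_eval v m * monom_eval v n"
proof -
  let ?S = "Poly_Mapping.keys m \<union> Poly_Mapping.keys n"
  have "Poly_Mapping.keys (m + n) \<subseteq> ?S" by (rule Poly_Mapping.keys_add)
  then show ?thesis
    by (simp add: monom_eval_superset[of ?S] lookup_add power_add prod.distrib)
qed

lemma monom_eval_single [simp]: "monom_eval v (Poly_Mapping.single x n) = v x ^ n"
  by (cases "n = 0") (auto simp: monom_eval_def)

lemma monom_eval_scale: "monom_eval (\<lambda>x. c * v x) m = c ^ mon_deg m * monom_eval v m"
  by (simp add: monom_eval_def mon_deg_def power_mult_distrib prod.distrib power_sum)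

lemma monom_eval_hom: "ring_map h \<Longrightarrow> h (monom_eval v m) = monom_eval (\<lambda>x. h (v x)) m"
  by (simp add: monom_eval_def ring_map_prod ring_mapD)

lemma subst_superset:
  assumes "ring_map h" "finite S" "Poly_Mapping.keys f \<subseteq> S"
  shows "subst h v f = (\<Sum>m\<in>S. h (Poly_Mapping.lookup f m) * monom_eval v m)"
  unfolding subst_def using assms
  by (intro sum.mono_neutral_left) (auto simp: in_keys_iff ring_mapD)

lemma subst_add:
  assumes "ring_map h"
  shows "subst h v (f + g) = subst h v f + subst h v g"
proof -
  let ?S = "Poly_Mapping.keys f \<union> Poly_Mapping.keys g"
  have "Poly_Mapping.keys (f + g) \<subseteq> ?S" by (rule Poly_Mapping.keys_add)
  then show ?thesis
    by (simp add: subst_superset[OF assms, of ?S] lookup_add ring_mapD[OF assms] algebra_simps sum.distrib)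
qed

lemma subst_single: "ring_map h \<Longrightarrow> subst h v (Poly_Mapping.single m c) = h c * monom_eval v m"
  by (cases "c = 0") (auto simp: subst_def ring_mapD)

lemma sum_single:
  fixes f :: "'v \<Rightarrow>\<^sub>0 'b::comm_monoid_add"
  shows "(\<Sum>m\<in>Poly_Mapping.keys f. Poly_Mapping.single m (Poly_Mapping.lookup f m)) = f"
proof (rule poly_mapping_eqI)
  fix k
  show "Poly_Mapping.lookup (\<Sum>m\<in>Poly_Mapping.keys f. Poly_Mapping.single m (Poly_Mapping.lookup f m)) k
    = Poly_Mapping.lookup f k"
    by (cases "k \<in> Poly_Mapping.keys f") (auto simp: lookup_sum lookup_single when_def in_keys_iff)
qed

lemma poly_mapping_induct [case_names add single]:
  fixes f :: "'v \<Rightarrow>\<^sub>0 'b::comm_monoid_add"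
  assumes "\<And>f g. P f \<Longrightarrow> P g \<Longrightarrow> P (f + g)" "\<And>m c. P (Poly_Mapping.single m c)"
  shows "P f"
proof -
  have "P (\<Sum>m\<in>S. Poly_Mapping.single m (Poly_Mapping.lookup f m))" if "finite S" for S
    using that by induction (use assms(2)[where c=0] in \<open>auto intro: assms\<close>)
  from this[of "Poly_Mapping.keys f"] show ?thesis by (simp add: sum_single)
qed

lemma subst_mult:
  assumes "ring_map h"
  shows "subst h v (f * g) = subst h v f * subst h v g"
proof (induction f rule: poly_mapping_induct)
  case (add f f')
  then show ?case by (simp add: algebra_simps subst_add[OF assms])
next
  case (single m c)
  show ?case
  proof (induction g rule: poly_mapping_induct)
    case (add g g')
    then show ?case by (simp add: algebra_simps subst_add[OF assms])
  next
    case (single n d)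
    show ?case
      by (simp add: mult_single subst_single[OF assms] monom_eval_add ring_mapD[OF assms])
  qed
qed

lemma ring_map_subst: "ring_map h \<Longrightarrow> ring_map (subst h v)"
  unfolding ring_map_def[of "subst h v"]
  by (auto simp: subst_add subst_mult ring_mapD subst_single single_one[symmetric] simp del: single_one)

lemma subst_hom: "ring_map g \<Longrightarrow> ring_map h \<Longrightarrow> g (subst h v f) = subst (\<lambda>c. g (h c)) (\<lambda>x. g (v x)) f"
  by (simp add: subst_def ring_map_sum ring_mapD monom_eval_hom)

lemma subst_homogeneous:
  assumes "homogeneous d f"
  shows "subst h (\<lambda>x. c * v x) f = c ^ d * subst h v f"
  using assms unfolding subst_def
  by (auto simp: homogeneous_def monom_eval_scale sum_distrib_left algebra_simps intro!: sum.cong)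

lemma subst_cong:
  assumes "is_ideal q" "\<And>x. v x - w x \<in> q"
  shows "subst h v f - subst h w f \<in> q"
proof -
  have "monom_eval v m - monom_eval w m \<in> q" for m
    unfolding monom_eval_def by (intro cong_prod cong_power assms)
  then have "(\<Sum>m\<in>Poly_Mapping.keys f. h (Poly_Mapping.lookup f m) * (monom_eval v m - monom_eval w m)) \<in> q"
    by (intro is_ideal_sum is_idealD(3) assms(1))
  then show ?thesis by (simp add: subst_def right_diff_distrib sum_subtractf)
qed

definition Const :: "complex \<Rightarrow> 'n sym_poly" where "Const c = Poly_Mapping.single 0 c"

definition Var :: "'n uprod \<Rightarrow> 'n sym_poly" where
  "Var e = Poly_Mapping.single (Poly_Mapping.single e 1) 1"

lemma ring_map_Const: "ring_map Const"
  by (auto simp: ring_map_def Const_def single_add mult_single)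

lemma ring_map_id: "ring_map (\<lambda>x. x)"
  by (auto simp: ring_map_def)

lemma ring_map_pConst: "ring_map (\<lambda>c. [:c:])"
  by (auto simp: ring_map_def one_pCons)

lemma ring_map_poly: "ring_map (\<lambda>f. poly f c)"
  by (auto simp: ring_map_def)

lemma ring_map_CC: "ring_map (\<lambda>c. [:Const c:])"
  by (auto simp: ring_map_def one_pCons ring_mapD[OF ring_map_Const])

lemma monom_Var: "monom_eval Var m = Poly_Mapping.single m 1"
proof -
  have *: "Var e ^ k = Poly_Mapping.single (Poly_Mapping.single e k) 1" for e :: "'a uprod" and k
    by (induction k) (auto simp: Var_def mult_single single_add[symmetric])
  have "(\<Prod>x\<in>S. Var x ^ f x) = Poly_Mapping.single (\<Sum>x\<in>S. Poly_Mapping.single x (f x)) 1"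
    if "finite S" for S :: "'a uprod set" and f
    using that by (induction S) (auto simp: * mult_single)
  then show ?thesis by (simp add: monom_eval_def sum_single)
qed

lemma subst_Const_Var: "subst Const Var f = f"
  by (simp add: subst_def monom_Var Const_def mult_single sum_single)

lemma homogeneous_Var: "homogeneous 1 (Var e)"
  by (auto simp: homogeneous_def Var_def mon_deg_def)

lemma homogeneous_Const: "homogeneous 0 (Const c)"
  by (auto simp: homogeneous_def Const_def mon_deg_def)

lemma homogeneous_1: "homogeneous 0 1"
  using homogeneous_Const[of 1] by (simp add: ring_mapD[OF ring_map_Const])

lemma homogeneous_0: "homogeneous d 0"
  by (auto simp: homogeneous_def)

lemma homogeneous_add: "homogeneous d f \<Longrightarrow> homogeneous d g \<Longrightarrow> homogeneous d (f + g)"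
  using Poly_Mapping.keys_add[of f g] unfolding homogeneous_def by blast

lemma homogeneous_uminus: "homogeneous d f \<Longrightarrow> homogeneous d (- f)"
  by (auto simp: homogeneous_def)

lemma homogeneous_diff: "homogeneous d f \<Longrightarrow> homogeneous d g \<Longrightarrow> homogeneous d (f - g)"
  using homogeneous_add[of d f "- g"] homogeneous_uminus[of d g] by simp

lemma homogeneous_sum: "(\<And>i. i \<in> A \<Longrightarrow> homogeneous d (f i)) \<Longrightarrow> homogeneous d (sum f A)"
  by (induction A rule: infinite_finite_induct) (auto simp: homogeneous_0 homogeneous_add)

lemma homogeneous_power: "homogeneous d f \<Longrightarrow> homogeneous (k * d) (f ^ k)"
  by (induction k) (auto simp: homogeneous_1 intro: homogeneous_mult)

lemma homogeneous_single: "homogeneous (mon_deg m) (Poly_Mapping.single m c)"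
  by (auto simp: homogeneous_def)


section \<open>Homogeneous components\<close>

text \<open>The homogeneous components are collected as the coefficients of a polynomial in one variable
  that marks the degree. This is a ring homomorphism, which takes care of the components of
  products.\<close>

definition grading :: "'n sym_poly \<Rightarrow> 'n sym_poly poly" where
  "grading = subst (\<lambda>c. [:Const c:]) (\<lambda>e. [:0, 1:] * [:Var e:])"

abbreviation component :: "nat \<Rightarrow> 'n sym_poly \<Rightarrow> 'n sym_poly" where
  "component d f \<equiv> coeff (grading f) d"

definition graded :: "'n sym_poly set \<Rightarrow> bool" where
  "graded J \<longleftrightarrow> (\<forall>f\<in>J. grading f \<in> poly_ideal J)"

lemma ring_map_grading: "ring_map grading"
  unfolding grading_def by (intro ring_map_subst ring_map_CC)

lemma grading_homogeneous:
  assumes "homogeneous d f" shows "grading f = Polynomial.monom f d"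
proof -
  have "grading f = [:0, 1:] ^ d * subst (\<lambda>c. [:Const c:]) (\<lambda>e. [:Var e:]) f"
    unfolding grading_def by (rule subst_homogeneous[OF assms])
  also have "subst (\<lambda>c. [:Const c:]) (\<lambda>e. [:Var e:]) f = [:f:]"
    using subst_hom[OF ring_map_pConst ring_map_Const, of Var f] by (simp add: subst_Const_Var)
  finally show ?thesis
    by (simp add: Polynomial.monom_altdef)
qed

lemma homogeneous_component: "homogeneous d (component d f)"
proof (induction f rule: poly_mapping_induct)
  case (add f g)
  then show ?case by (simp add: ring_mapD[OF ring_map_grading] homogeneous_add)
next
  case (single m c)
  show ?case
    by (auto simp: grading_homogeneous[OF homogeneous_single] coeff_monom homogeneous_0
        homogeneous_single)
qed

lemma poly_grading: "poly (grading f) (Const s) = subst Const (\<lambda>e. Const s * Var e) f"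
  unfolding grading_def by (subst subst_hom[OF ring_map_poly ring_map_CC]) simp

lemma sum_component: "f = (\<Sum>d\<le>degree (grading f). component d f)"
proof -
  have "f = poly (grading f) (Const 1)"
    unfolding poly_grading by (simp add: ring_mapD(1)[OF ring_map_Const] subst_Const_Var)
  also have "\<dots> = (\<Sum>d\<le>degree (grading f). component d f)"
    by (subst poly_altdef) (simp add: ring_mapD[OF ring_map_Const])
  finally show ?thesis .
qed

lemma component_homogeneous: "homogeneous d f \<Longrightarrow> component k f = (if k = d then f else 0)"
  by (simp add: grading_homogeneous coeff_monom)

lemma graded_iff:
  assumes "is_ideal J" "graded J"
  shows "f \<in> J \<longleftrightarrow> grading f \<in> poly_ideal J"
proof
  assume "grading f \<in> poly_ideal J"
  then have "(\<Sum>d\<le>degree (grading f). component d f) \<in> J"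
    by (intro is_ideal_sum assms) (simp add: poly_ideal_def)
  then show "f \<in> J" by (simp flip: sum_component)
qed (use assms(2) in \<open>simp add: graded_def\<close>)

text \<open>The polynomials all of whose components lie in \<open>J\<close> form an ideal that contains the homogeneous
  elements of \<open>J\<close>, hence the ideal that they generate.\<close>

lemma homogeneous_ideal_iff: "homogeneous_ideal J \<longleftrightarrow> is_ideal J \<and> graded J"
proof
  assume J: "homogeneous_ideal J"
  then have id: "is_ideal J" by (simp add: homogeneous_ideal_def is_ideal_iff)
  let ?K = "{f. grading f \<in> poly_ideal J}"
  have "is_ideal ?K"
    by (intro is_ideal_vimage ring_map_grading is_ideal_poly_ideal id)
  moreover have "{f \<in> J. \<exists>d. homogeneous d f} \<subseteq> ?K"
    using is_idealD(1)[OF id] by (auto simp: grading_homogeneous poly_ideal_def coeff_monom)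
  ultimately have "J \<subseteq> ?K"
    using J genideal_least[of ?K "{f \<in> J. \<exists>d. homogeneous d f}"]
    by (simp add: homogeneous_ideal_def is_ideal_iff)
  then show "is_ideal J \<and> graded J" using id by (auto simp: graded_def)
next
  assume *: "is_ideal J \<and> graded J"
  let ?G = "genideal sym_poly_ring {f \<in> J. \<exists>d. homogeneous d f}"
  have G: "is_ideal ?G" using ideal_genideal is_ideal_iff by blast
  have "f \<in> ?G" if "f \<in> J" for f
  proof -
    have "component d f \<in> ?G" for d
      using that * homogeneous_component[of d f] genideal_subset[of "{f \<in> J. \<exists>d. homogeneous d f}"]
      by (auto simp: graded_def poly_ideal_def)
    then have "(\<Sum>d\<le>degree (grading f). component d f) \<in> ?G" by (intro is_ideal_sum G)
    then show ?thesis by (simp flip: sum_component)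
  qed
  moreover have "?G \<subseteq> J" using * by (intro genideal_least) (auto simp: is_ideal_iff)
  ultimately show "homogeneous_ideal J"
    using * unfolding homogeneous_ideal_def is_ideal_iff by blast
qed

text \<open>Split off the linear factor of one of the scalars. Differences of distinct scalars are units, so
  the quotient takes values in \<open>J\<close> at the other scalars, and its degree is smaller.\<close>

lemma poly_ideal_if_infinite_values:
  fixes f :: "'n sym_poly poly"
  assumes J: "is_ideal J" and S: "infinite S" and val: "\<And>s. s \<in> S \<Longrightarrow> poly f (Const s) \<in> J"
  shows "f \<in> poly_ideal J"
  using S val
proof (induction "degree f" arbitrary: f S)
  case 0
  then obtain s where "s \<in> S" by (metis infinite_imp_nonempty all_not_in_conv)
  moreover obtain a where "f = [:a:]" using degree_eq_zeroE[of f] 0(1) by metis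
  ultimately show ?case
    using 0(3)[of s] is_idealD(1)[OF J] by (auto simp: poly_ideal_def coeff_pCons split: nat.split)
next
  case (Suc n)
  then obtain s where s: "s \<in> S" by (metis infinite_imp_nonempty all_not_in_conv)
  let ?g = "synthetic_div f (Const s)"
  have f: "[:- Const s, 1:] * ?g + [:poly f (Const s):] = f" by (rule synthetic_div_correct')
  have "poly ?g (Const t) \<in> J" if t: "t \<in> S - {s}" for t
  proof -
    have "poly f (Const t) = (Const t - Const s) * poly ?g (Const t) + poly f (Const s)"
      by (subst f[symmetric]) (simp add: algebra_simps)
    then have "(Const t - Const s) * poly ?g (Const t) \<in> J"
      using Suc.prems(2)[of t] Suc.prems(2)[OF s] t J is_ideal_add_iff(2)[of J "poly f (Const s)"]
      by auto
    then have "Const (1 / (t - s)) * ((Const t - Const s) * poly ?g (Const t)) \<in> J"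
      by (rule is_idealD[OF J])
    moreover have "Const (1 / (t - s)) * (Const t - Const s) = (1 :: 'n sym_poly)"
      using t ring_mapD(1,3,6)[OF ring_map_Const] by (metis eq_iff_diff_eq_0 insert_iff Diff_iff nonzero_eq_divide_eq)
    then have "Const (1 / (t - s)) * ((Const t - Const s) * poly ?g (Const t)) = poly ?g (Const t)"
      by (simp only: mult.assoc[symmetric] mult_1)
    ultimately show ?thesis by (simp only:)
  qed
  then have "?g \<in> poly_ideal J"
    using Suc.hyps(1)[of ?g "S - {s}"] Suc.hyps(2) Suc.prems(1) by (simp add: degree_synthetic_div)
  moreover have "[:poly f (Const s):] \<in> poly_ideal J"
    using Suc.prems(2)[OF s] is_idealD(1)[OF J] by (auto simp: poly_ideal_def coeff_pCons split: nat.split)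
  ultimately have "[:- Const s, 1:] * ?g + [:poly f (Const s):] \<in> poly_ideal J"
    by (rule is_idealD(2)[OF is_ideal_poly_ideal[OF J] is_idealD(3)[OF is_ideal_poly_ideal[OF J]]])
  then show ?case by (simp only: f)
qed


section \<open>Rank of symmetric complex matrices\<close>

lemma span_rows_row: "row i A \<in> vec.span (rows A)"
  by (intro vec.span_base) (auto simp: rows_def)

lemma rank_le_if_rows:
  fixes A M :: "complex^'n^'n"
  assumes "\<And>i. row i M \<in> vec.span S"
  shows "rank M \<le> vec.dim S"
  unfolding row_rank_def_gen using assms
  by (intro vec.dim_mono) (auto simp: rows_def)

text \<open>The row space of \<open>M\<close> lies in that of \<open>A\<close>, and \<open>M\<close> kills \<open>x\<close>. But some row of \<open>A\<close> does not vanish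
  at \<open>x\<close>, unless \<open>A x = 0\<close>, in which case \<open>M = 0\<close>.\<close>

lemma rank_Lagrange_step:
  fixes A :: "complex^'n^'n" and x :: "'n \<Rightarrow> complex"
  defines "u \<equiv> \<lambda>i. \<Sum>j\<in>UNIV. A $ i $ j * x j"
  defines "M \<equiv> (\<chi> i j. (\<Sum>k\<in>UNIV. x k * u k) * A $ i $ j - u i * u j) :: complex^'n^'n"
  assumes sym: "transpose A = A"
  shows "M = 0 \<or> rank M < rank A"
proof (cases "\<forall>i. u i = 0")
  case True
  then show ?thesis by (auto simp: M_def vec_eq_iff)
next
  case False
  then obtain i0 where i0: "u i0 \<noteq> 0" by blast
  have symA: "A $ i $ j = A $ j $ i" for i j
    using sym by (metis transpose_def vec_lambda_beta)
  let ?u = "(\<chi> j. u j) :: complex^'n"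
  let ?K = "{v :: complex^'n. (\<Sum>j\<in>UNIV. x j * v $ j) = 0}"
  have u_span: "?u \<in> vec.span (rows A)"
  proof -
    have "?u = (\<Sum>k\<in>UNIV. x k *s row k A)"
      by (auto simp: vec_eq_iff u_def row_def symA mult.commute)
    also have "\<dots> \<in> vec.span (rows A)"
      by (intro vec.span_sum vec.span_scale span_rows_row)
    finally show ?thesis .
  qed
  have row_M: "row i M = (\<Sum>k\<in>UNIV. x k * u k) *s row i A - u i *s ?u" for i
    by (auto simp: vec_eq_iff row_def M_def)
  have sub: "vec.span (rows M) \<subseteq> vec.span (rows A)"
  proof (intro vec.span_minimal vec.subspace_span)
    have "row i M \<in> vec.span (rows A)" for i
      unfolding row_M by (intro vec.span_diff vec.span_scale u_span span_rows_row)
    then show "rows M \<subseteq> vec.span (rows A)" by (auto simp: rows_def[of M])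
  qed
  have "vec.subspace ?K"
    by (auto simp: vec.subspace_def algebra_simps sum.distrib sum_distrib_left[symmetric])
  moreover have "row i M \<in> ?K" for i
  proof -
    have "(\<Sum>j\<in>UNIV. x j * row i M $ j)
        = (\<Sum>k\<in>UNIV. x k * u k) * (\<Sum>j\<in>UNIV. A $ i $ j * x j) - u i * (\<Sum>j\<in>UNIV. x j * u j)"
      by (simp add: row_def M_def algebra_simps sum_subtractf sum_distrib_left)
    also have "(\<Sum>j\<in>UNIV. A $ i $ j * x j) = u i" by (simp add: u_def)
    also have "(\<Sum>k\<in>UNIV. x k * u k) * u i - u i * (\<Sum>j\<in>UNIV. x j * u j) = 0" by simp
    finally show ?thesis by simp
  qed
  ultimately have "vec.span (rows M) \<subseteq> ?K"
    by (intro vec.span_minimal) (auto simp: rows_def)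
  moreover have "row i0 A \<notin> ?K"
    using i0 by (simp add: u_def row_def mult.commute)
  ultimately have "vec.span (rows M) \<subset> vec.span (rows A)"
    using sub span_rows_row[of i0 A] by blast
  then show ?thesis unfolding row_rank_def_gen by (intro disjI2 vec.dim_psubset)
qed

lemma rank_add_outer:
  fixes A :: "complex^'n^'n"
  shows "rank (\<chi> i j. c * A $ i $ j + u i * u j) \<le> Suc (rank A)"
proof -
  let ?u = "(\<chi> j. u j) :: complex^'n"
  let ?M = "(\<chi> i j. c * A $ i $ j + u i * u j) :: complex^'n^'n"
  have "row i ?M = c *s row i A + u i *s ?u" for i
    by (auto simp: vec_eq_iff row_def)
  moreover have "row i A \<in> vec.span (insert ?u (rows A))" for i
    using span_rows_row[of i A] vec.span_mono[of "rows A" "insert ?u (rows A)"] by blast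
  ultimately have "rank ?M \<le> vec.dim (insert ?u (rows A))"
    by (intro rank_le_if_rows) (auto intro!: vec.span_add vec.span_scale vec.span_base[of ?u])
  also have "\<dots> \<le> Suc (rank A)"
    by (simp add: vec.dim_insert row_rank_def_gen)
  finally show ?thesis .
qed

lemma rank_scale_le: "rank (\<chi> i j. c * A $ i $ j) \<le> rank (A :: complex^'n^'n)"
proof -
  have "row i (\<chi> i j. c * A $ i $ j) = c *s row i A" for i
    by (auto simp: vec_eq_iff row_def)
  then show ?thesis
    by (subst (2) row_rank_def_gen) (auto intro!: rank_le_if_rows vec.span_scale span_rows_row)
qed

lemma rank_zero_matrix: "rank (0 :: complex^'n^'n) = 0"
  using rank_le_if_rows[of "0 :: complex^'n^'n" "{}"] by (simp add: row_def zero_vec_def[symmetric] vec_eq_iff)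


section \<open>Symmetric matrices of polynomials\<close>

text \<open>An ordering of each unordered pair is chosen, so that a family indexed by ordered pairs can be
  read as a family indexed by the variables. For symmetric families every choice gives
  the same result.\<close>

definition fst_index :: "'n uprod \<Rightarrow> 'n" where "fst_index e = (SOME i. \<exists>j. e = Upair i j)"

definition snd_index :: "'n uprod \<Rightarrow> 'n" where "snd_index e = (SOME j. e = Upair (fst_index e) j)"

definition entries :: "('n \<Rightarrow> 'n \<Rightarrow> 'b) \<Rightarrow> 'n uprod \<Rightarrow> 'b" where
  "entries M e = M (fst_index e) (snd_index e)"

lemma Upair_index: "Upair (fst_index e) (snd_index e) = e"
proof -
  have "\<exists>j. e = Upair (fst_index e) j"
    unfolding fst_index_def by (rule someI_ex) (metis uprod_exhaust)
  then show ?thesis unfolding snd_index_def by (metis (mono_tags, lifting) someI_ex)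
qed

definition generic :: "'n \<Rightarrow> 'n \<Rightarrow> 'n sym_poly" where "generic i j = Var (Upair i j)"

definition mat_vec :: "('n::finite \<Rightarrow> 'n \<Rightarrow> 'b::comm_ring_1) \<Rightarrow> ('n \<Rightarrow> 'b) \<Rightarrow> 'n \<Rightarrow> 'b" where
  "mat_vec M x i = (\<Sum>j\<in>UNIV. M i j * x j)"

definition quad :: "('n::finite \<Rightarrow> 'n \<Rightarrow> 'b::comm_ring_1) \<Rightarrow> ('n \<Rightarrow> 'b) \<Rightarrow> 'b" where
  "quad M x = (\<Sum>k\<in>UNIV. x k * mat_vec M x k)"

text \<open>Lagrange's reduction step \<open>(x\<^sup>T M x) M - (M x) (M x)\<^sup>T\<close>, which splits off the square of the
  linear form \<open>x\<^sup>T M\<close> without dividing by \<open>x\<^sup>T M x\<close>.\<close>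

definition Lagrange :: "('n::finite \<Rightarrow> 'n \<Rightarrow> 'b::comm_ring_1) \<Rightarrow> ('n \<Rightarrow> 'b) \<Rightarrow> 'n \<Rightarrow> 'n \<Rightarrow> 'b" where
  "Lagrange M x i j = quad M x * M i j - mat_vec M x i * mat_vec M x j"

lemma generic_sym: "generic i j = generic j i"
proof -
  have "Upair i j = Upair j i" by simp
  then show ?thesis by (simp only: generic_def)
qed

lemma mat_vec_hom: "ring_map h \<Longrightarrow> h (mat_vec M x i) = mat_vec (\<lambda>i j. h (M i j)) (\<lambda>j. h (x j)) i"
  by (simp add: mat_vec_def ring_map_sum ring_mapD)

lemma quad_hom: "ring_map h \<Longrightarrow> h (quad M x) = quad (\<lambda>i j. h (M i j)) (\<lambda>j. h (x j))"
  by (simp add: quad_def ring_map_sum ring_mapD mat_vec_hom)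

lemma Lagrange_hom:
  "ring_map h \<Longrightarrow> h (Lagrange M x i j) = Lagrange (\<lambda>i j. h (M i j)) (\<lambda>j. h (x j)) i j"
  by (simp add: Lagrange_def ring_mapD quad_hom mat_vec_hom)

lemma Lagrange_sym: "(\<And>i j. M i j = M j i) \<Longrightarrow> Lagrange M x i j = Lagrange M x j i"
  by (metis Lagrange_def mult.commute)

lemma sym_eval_subst: "sym_eval f A = subst (\<lambda>c. c) (sym_entry A) f"
  by (simp add: sym_eval_def subst_def monom_eval_def)

lemma ring_map_sym_eval: "ring_map (\<lambda>f. sym_eval f A)"
  unfolding sym_eval_subst by (intro ring_map_subst ring_map_id)

lemma sym_eval_Const [simp]: "sym_eval (Const c) A = c"
  by (simp add: sym_eval_subst Const_def subst_single[OF ring_map_id])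

lemma sym_eval_Var [simp]: "sym_eval (Var e) A = sym_entry A e"
  by (simp add: sym_eval_subst Var_def subst_single[OF ring_map_id])

lemma sym_entry_entries:
  assumes "\<And>i j. M i j = M j i"
  shows "sym_entry (\<chi> i j. M i j) = entries M"
proof
  fix e :: "'a uprod"
  have "transpose (\<chi> i j. M i j) = (\<chi> i j. M i j)"
    using assms by (auto simp: transpose_def vec_eq_iff)
  from sym_entry_Upair[OF this, of "fst_index e" "snd_index e"]
  show "sym_entry (\<chi> i j. M i j) e = entries M e"
    by (simp add: Upair_index entries_def)
qed

lemma sym_eval_generic: "transpose A = A \<Longrightarrow> sym_eval (generic i j) A = A $ i $ j"
  by (simp add: generic_def sym_entry_Upair)

lemma sym_eval_subst_entries:
  fixes M :: "'n::finite \<Rightarrow> 'n \<Rightarrow> 'n sym_poly"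
  assumes "\<And>i j. M i j = M j i"
  shows "sym_eval (subst Const (entries M) f) A = sym_eval f (\<chi> i j. sym_eval (M i j) A)"
proof -
  have "sym_eval (subst Const (entries M) f) A = subst (\<lambda>c. c) (\<lambda>e. sym_eval (entries M e) A) f"
    using subst_hom[OF ring_map_sym_eval[of A] ring_map_Const, of "entries M" f] by simp
  also have "(\<lambda>e. sym_eval (entries M e) A) = sym_entry (\<chi> i j. sym_eval (M i j) A)"
    using assms by (subst sym_entry_entries) (auto simp: entries_def)
  finally show ?thesis by (simp add: sym_eval_subst)
qed

lemma is_ideal_S_ideal: "is_ideal (S_ideal r)"
  by (subst is_ideal_def) (auto simp: S_ideal_def ring_mapD[OF ring_map_sym_eval])

text \<open>The matrices of rank at most \<open>r\<close> are stable under nonzero scalars, of which there are infinitely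
  many.\<close>

lemma graded_S_ideal: "graded (S_ideal r :: 'n::finite sym_poly set)"
  unfolding graded_def
proof
  fix f :: "'n sym_poly" assume f: "f \<in> S_ideal r"
  show "grading f \<in> poly_ideal (S_ideal r)"
  proof (rule poly_ideal_if_infinite_values[OF is_ideal_S_ideal])
    show "infinite (UNIV - {0 :: complex})" by (intro infinite_remove infinite_UNIV_char_0)
    fix s :: complex assume s: "s \<in> UNIV - {0}"
    show "poly (grading f) (Const s) \<in> S_ideal r"
      unfolding S_ideal_def
    proof (intro CollectI ballI)
      fix A :: "complex^'n^'n" assume A: "A \<in> sym_rank_le r"
      then have symA: "transpose A = A" by (simp add: sym_rank_le_def)
      have symA': "A $ i $ j = A $ j $ i" for i j
        using symA by (metis transpose_def vec_lambda_beta)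
      let ?M = "\<lambda>i j. Const s * generic i j :: 'n sym_poly"
      have "entries ?M = (\<lambda>e. Const s * Var e)"
        by (rule ext) (simp add: entries_def generic_def Upair_index)
      then have "poly (grading f) (Const s) = subst Const (entries ?M) f"
        by (simp add: poly_grading)
      then have "sym_eval (poly (grading f) (Const s)) A = sym_eval f (\<chi> i j. sym_eval (?M i j) A)"
        using sym_eval_subst_entries[of ?M f A] generic_sym by metis
      also have "(\<chi> i j. sym_eval (?M i j) A) = (\<chi> i j. s * A $ i $ j)"
        by (simp add: ring_mapD[OF ring_map_sym_eval] sym_eval_generic[OF symA])
      also have "\<dots> \<in> sym_rank_le r"
      proof -
        have "(\<chi> i j. s * A $ i $ j) \<noteq> 0" using A s by (auto simp: sym_rank_le_def vec_eq_iff)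
        moreover have "rank (\<chi> i j. s * A $ i $ j) \<le> r"
          using rank_scale_le[of s A] A by (auto simp: sym_rank_le_def)
        moreover have "transpose (\<chi> i j. s * A $ i $ j) = (\<chi> i j. s * A $ i $ j)"
          using symA' by (auto simp: transpose_def vec_eq_iff)
        ultimately show ?thesis by (simp add: sym_rank_le_def)
      qed
      then have "sym_eval f (\<chi> i j. s * A $ i $ j) = 0" using f by (simp add: S_ideal_def)
      finally show "sym_eval (poly (grading f) (Const s)) A = 0" .
    qed
  qed
qed

text \<open>The zero matrix is not a point of projective space; \<open>f\<close> vanishes there because it is homogeneous of
  positive degree.\<close>

lemma subst_entries_in_S_ideal:
  fixes M :: "'n::finite \<Rightarrow> 'n \<Rightarrow> 'n sym_poly"
  assumes f: "f \<in> S_ideal k" "homogeneous n f" "0 < n" and sym: "\<And>i j. M i j = M j i"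
    and rank: "\<And>A. A \<in> sym_rank_le r \<Longrightarrow>
      (\<chi> i j. sym_eval (M i j) A) = (0 :: complex^'n^'n) \<or> rank (\<chi> i j. sym_eval (M i j) A) \<le> k"
  shows "subst Const (entries M) f \<in> S_ideal r"
  unfolding S_ideal_def
proof (intro CollectI ballI)
  fix A :: "complex^'n^'n" assume A: "A \<in> sym_rank_le r"
  let ?M = "(\<chi> i j. sym_eval (M i j) A) :: complex^'n^'n"
  have "sym_eval f ?M = 0"
  proof (cases "?M = 0")
    case True
    have "sym_entry (0 :: complex^'n^'n) = (\<lambda>e. 0)"
      using sym_entry_entries[of "\<lambda>i j :: 'n. 0 :: complex"] by (simp add: entries_def[abs_def] zero_vec_def)
    moreover have "subst (\<lambda>c. c) (\<lambda>e. 0 * 0) f = 0 ^ n * subst (\<lambda>c. c) (\<lambda>e. 0 :: complex) f"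
      by (rule subst_homogeneous[OF f(2)])
    ultimately have "sym_eval f (0 :: complex^'n^'n) = 0"
      by (simp only: sym_eval_subst zero_power[OF f(3)] mult_zero_left)
    then show ?thesis by (simp only: True)
  next
    case False
    moreover have "transpose ?M = ?M" using sym by (auto simp: transpose_def vec_eq_iff)
    ultimately have "?M \<in> sym_rank_le k" using rank[OF A] by (simp add: sym_rank_le_def)
    then show ?thesis using f(1) by (simp add: S_ideal_def)
  qed
  then show "sym_eval (subst Const (entries M) f) A = 0"
    by (simp add: sym_eval_subst_entries sym)
qed

text \<open>The reduction step lowers the rank of every complex matrix of rank at most \<open>r\<close>. Since the reduced
  matrix is a polynomial in \<open>A\<close>, this says that a polynomial lies in the ideal of \<open>S\<^sub>r(N)\<close>, and
  the conclusion passes to matrices over the coordinate ring of any subscheme.\<close>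

lemma subst_Lagrange_in_S_ideal:
  fixes x :: "'n::finite \<Rightarrow> complex"
  assumes f: "f \<in> S_ideal (r - 1)" "homogeneous n f" "0 < n"
  shows "subst Const (entries (Lagrange generic (\<lambda>j. Const (x j)))) f \<in> S_ideal r"
proof (rule subst_entries_in_S_ideal[OF f])
  show "Lagrange generic (\<lambda>j. Const (x j)) i j = Lagrange generic (\<lambda>j. Const (x j)) j i" for i j :: 'n
    by (rule Lagrange_sym) (rule generic_sym)
  fix A :: "complex^'n^'n" assume A: "A \<in> sym_rank_le r"
  then have symA: "transpose A = A" by (simp add: sym_rank_le_def)
  let ?M = "(\<chi> i j. sym_eval (Lagrange generic (\<lambda>j. Const (x j)) i j) A) :: complex^'n^'n"
  have "?M = (\<chi> i j. (\<Sum>k\<in>UNIV. x k * (\<Sum>j\<in>UNIV. A $ k $ j * x j)) * A $ i $ j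
      - (\<Sum>k\<in>UNIV. A $ i $ k * x k) * (\<Sum>k\<in>UNIV. A $ j $ k * x k))"
    by (simp add: Lagrange_def quad_def mat_vec_def sym_eval_generic[OF symA]
        ring_mapD[OF ring_map_sym_eval] ring_map_sum[OF ring_map_sym_eval])
  then have "?M = 0 \<or> rank ?M < rank A"
    using rank_Lagrange_step[OF symA, of x] by simp
  then show "?M = 0 \<or> rank ?M \<le> r - 1" using A by (auto simp: sym_rank_le_def)
qed

text \<open>The vector \<open>x\<close> may move along a curve, because it suffices to test the curve at all scalars.\<close>

lemma subst_Lagrange_curve_in_S_ideal:
  fixes x :: "'n::finite \<Rightarrow> 'n sym_poly poly" and \<xi> :: "complex \<Rightarrow> 'n \<Rightarrow> complex"
  assumes f: "f \<in> S_ideal (r - 1)" "homogeneous n f" "0 < n"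
    and x: "\<And>s j. poly (x j) (Const s) = Const (\<xi> s j)"
  shows "subst (\<lambda>c. [:Const c:]) (entries (Lagrange (\<lambda>i j. [:generic i j:]) x)) f
    \<in> poly_ideal (S_ideal r)"
proof (rule poly_ideal_if_infinite_values[OF is_ideal_S_ideal infinite_UNIV_char_0])
  fix s :: complex
  have "poly (subst (\<lambda>c. [:Const c:]) (entries (Lagrange (\<lambda>i j. [:generic i j:]) x)) f) (Const s)
      = subst Const (entries (Lagrange generic (\<lambda>j. Const (\<xi> s j)))) f"
    by (subst subst_hom[OF ring_map_poly ring_map_CC])
      (simp add: entries_def[abs_def] Lagrange_hom[OF ring_map_poly] x)
  then show "poly (subst (\<lambda>c. [:Const c:]) (entries (Lagrange (\<lambda>i j. [:generic i j:]) x)) f) (Const s)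
      \<in> S_ideal r"
    using subst_Lagrange_in_S_ideal[OF f] by simp
qed


section \<open>Pivots of the generic matrix\<close>

abbreviation Cvec :: "('n \<Rightarrow> complex) \<Rightarrow> 'n \<Rightarrow> 'n sym_poly" where "Cvec x \<equiv> \<lambda>j. Const (x j)"

text \<open>Polarization: \<open>2 M a b\<close> is a combination of the values at \<open>\<delta>\<^sub>a + \<delta>\<^sub>b\<close>, \<open>\<delta>\<^sub>a\<close> and \<open>\<delta>\<^sub>b\<close>.\<close>

lemma ex_quad_notin:
  fixes M :: "'n::finite \<Rightarrow> 'n \<Rightarrow> 'n sym_poly"
  assumes p: "is_ideal p" and sym: "\<And>i j. M i j = M j i" and ab: "M a b \<notin> p"
  shows "\<exists>x. quad M (Cvec x) \<notin> p"
proof (rule ccontr)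
  assume "\<not> ?thesis"
  then have q: "quad M (Cvec x) \<in> p" for x by blast
  define \<delta> where "\<delta> = (\<lambda>a j :: 'n. if j = a then 1 else 0 :: complex)"
  have C: "Const (\<delta> a j) = (if j = a then 1 else 0)" for a j
    by (simp add: \<delta>_def ring_mapD[OF ring_map_Const])
  have diag: "quad M (Cvec (\<delta> a)) = M a a" for a
    by (simp add: quad_def mat_vec_def C if_distrib[of "\<lambda>x. _ * x"] if_distrib[of "\<lambda>x. x * _"] cong: if_cong)
  have "quad M (Cvec (\<lambda>j. \<delta> a j + \<delta> b j)) = M a a + M a b + (M b a + M b b)"
    by (simp add: quad_def mat_vec_def ring_mapD[OF ring_map_Const] C distrib_left distrib_right sum.distrib
       if_distrib[of "\<lambda>x. _ * x"] if_distrib[of "\<lambda>x. x * _"] cong: if_cong)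
  then have "M a b + M a b = quad M (Cvec (\<lambda>j. \<delta> a j + \<delta> b j)) - quad M (Cvec (\<delta> a)) - quad M (Cvec (\<delta> b))"
    by (simp add: diag sym[of b a])
  then have "M a b + M a b \<in> p" using q p by (simp add: is_idealD)
  then have "Const (1/2) * (M a b + M a b) \<in> p" by (rule is_idealD(3)[OF p])
  also have "Const (1/2) * (M a b + M a b) = (Const (1/2) + Const (1/2)) * M a b"
    by (simp add: algebra_simps)
  also have "\<dots> = M a b"
    by (simp flip: ring_mapD(2)[OF ring_map_Const]) (simp add: ring_mapD[OF ring_map_Const])
  finally show False using ab by blast
qed

lemma sum_mat_vec_swap:
  fixes M :: "'n::finite \<Rightarrow> 'n \<Rightarrow> 'b::comm_ring_1"
  assumes "\<And>i j. M i j = M j i"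
  shows "(\<Sum>j\<in>UNIV. mat_vec M x j * y j) = (\<Sum>k\<in>UNIV. x k * mat_vec M y k)"
proof -
  have "(\<Sum>j\<in>UNIV. mat_vec M x j * y j) = (\<Sum>j\<in>UNIV. \<Sum>k\<in>UNIV. M j k * x k * y j)"
    by (simp add: mat_vec_def sum_distrib_right)
  also have "\<dots> = (\<Sum>k\<in>UNIV. \<Sum>j\<in>UNIV. M j k * x k * y j)" by (rule sum.swap)
  also have "\<dots> = (\<Sum>k\<in>UNIV. x k * mat_vec M y k)"
    by (intro sum.cong refl) (simp add: mat_vec_def sum_distrib_left assms[of _ k for k] algebra_simps)
  finally show ?thesis .
qed

lemma mat_vec_Lagrange:
  fixes M :: "'n::finite \<Rightarrow> 'n \<Rightarrow> 'b::comm_ring_1"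
  assumes "\<And>i j. M i j = M j i"
  shows "mat_vec (Lagrange M x) y i
    = quad M x * mat_vec M y i - mat_vec M x i * (\<Sum>k\<in>UNIV. x k * mat_vec M y k)"
proof -
  have "mat_vec (Lagrange M x) y i
      = quad M x * mat_vec M y i - mat_vec M x i * (\<Sum>j\<in>UNIV. mat_vec M x j * y j)"
    unfolding mat_vec_def[of "Lagrange M x"] Lagrange_def
    by (simp add: left_diff_distrib sum_subtractf mult.assoc flip: sum_distrib_left)
      (simp add: mat_vec_def sum_distrib_left)
  then show ?thesis using sum_mat_vec_swap[of M x y, OF assms] by simp
qed

text \<open>The prime \<open>p\<close> is the ideal of a subvariety of \<open>S\<^sub>r(N)\<close>, and \<open>f\<close> witnesses that it is not contained in
  \<open>S\<^bsub>r-1\<^esub>(N)\<close>. So the generic matrix has rank exactly \<open>r\<close> modulo \<open>p\<close>.\<close>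

locale pivot_setup =
  fixes p :: "'n::finite sym_poly set" and r n :: nat and f :: "'n sym_poly"
  assumes p: "is_prime p" and Sp: "S_ideal r \<subseteq> p" and r: "1 \<le> r"
    and f: "f \<in> S_ideal (r - 1)" "f \<notin> p" "homogeneous n f" "0 < n"
begin

definition pairing :: "('n \<Rightarrow> 'n sym_poly) \<Rightarrow> ('n \<Rightarrow> complex) \<Rightarrow> 'n sym_poly" where
  "pairing w x = (\<Sum>i\<in>UNIV. w i * mat_vec generic (Cvec x) i)"

text \<open>The matrix with entries \<open>w l A x l'\<close> is triangular with nonzero diagonal modulo \<open>p\<close>. This expresses
  that \<open>A\<close> has rank at least \<open>k\<close>, by complex vectors \<open>x l\<close> and rows \<open>w l\<close> of forms.\<close>

definition pivots :: "nat \<Rightarrow> (nat \<Rightarrow> 'n \<Rightarrow> complex) \<Rightarrow> (nat \<Rightarrow> 'n \<Rightarrow> 'n sym_poly) \<Rightarrow> (nat \<Rightarrow> nat) \<Rightarrow> bool" where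
  "pivots k x w h \<longleftrightarrow> (\<forall>l<k. (\<forall>i. homogeneous (h l) (w l i)) \<and> pairing (w l) (x l) \<notin> p \<and>
     (\<forall>l'<l. pairing (w l) (x l') = 0)) \<and> (0 < k \<longrightarrow> quad generic (Cvec (x 0)) \<notin> p)"

text \<open>The state of Lagrange's reduction after \<open>k\<close> steps. The reduced matrix \<open>M = P A\<close> kills the vectors
  used so far, and \<open>H\<close> collects the \<open>k\<close> squares that were split off from the multiple \<open>c A\<close>.
  The last clause is there for the first vector, at which \<open>A\<close> itself is to be nonzero.\<close>

definition reduced :: "nat \<Rightarrow> (nat \<Rightarrow> 'n \<Rightarrow> complex) \<Rightarrow> ('n \<Rightarrow> 'n \<Rightarrow> 'n sym_poly) \<Rightarrow>
    ('n \<Rightarrow> 'n \<Rightarrow> 'n sym_poly) \<Rightarrow> ('n \<Rightarrow> 'n \<Rightarrow> 'n sym_poly) \<Rightarrow> nat \<Rightarrow> 'n sym_poly \<Rightarrow> bool" where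
  "reduced k x P M H d c \<longleftrightarrow>
     (\<forall>i j. homogeneous d (P i j)) \<and> (\<forall>i j. M i j = (\<Sum>l\<in>UNIV. P i l * generic l j)) \<and>
     (\<forall>i j. M i j = M j i) \<and> (\<forall>l<k. \<forall>i. mat_vec M (Cvec (x l)) i = 0) \<and>
     c \<notin> p \<and> (\<forall>i j. c * generic i j = M i j + H i j) \<and> (\<forall>i j. H i j = H j i) \<and>
     (\<forall>A. rank (\<chi> i j. sym_eval (H i j) A) \<le> k) \<and> (k = 0 \<longrightarrow> M = generic)"

definition reduction :: "nat \<Rightarrow> (nat \<Rightarrow> 'n \<Rightarrow> complex) \<Rightarrow> bool" where
  "reduction k x \<longleftrightarrow> (\<exists>P M H d c. reduced k x P M H d c)"

lemma reduction_0: "reduction 0 x"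
proof -
  let ?P = "\<lambda>i j. if i = j then 1 else 0 :: 'n sym_poly"
  have P: "homogeneous 0 (?P i j)" for i j by (simp add: homogeneous_0 homogeneous_1)
  have M: "generic i j = (\<Sum>l\<in>UNIV. ?P i l * generic l j)" for i j
    by (simp add: if_distrib[of "\<lambda>x. x * _"] cong: if_cong)
  have rk: "rank ((\<chi> i j. sym_eval (0 :: 'n sym_poly) A) :: complex^'n^'n) \<le> 0" for A :: "complex^'n^'n"
    using rank_zero_matrix by (simp add: ring_mapD[OF ring_map_sym_eval] zero_vec_def)
  have "reduced 0 x ?P generic (\<lambda>i j. 0) 0 1"
    unfolding reduced_def
    by (intro conjI allI impI) (rule P M rk generic_sym is_primeD(2)[OF p] | simp)+
  then show ?thesis unfolding reduction_def by (intro exI)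
qed

text \<open>If all entries of \<open>M\<close> were in \<open>p\<close>, then \<open>c A\<close> would agree modulo \<open>p\<close> with \<open>H\<close>, whose rank is at most
  \<open>k < r\<close>, and \<open>f\<close> would lie in \<open>p\<close>. So some quadratic value of \<open>M\<close> is not in \<open>p\<close>, and its vector
  is used for the next step.\<close>

lemma reduction_Suc:
  assumes k: "k < r" and piv: "pivots k x w h" and red: "reduction k x"
  shows "\<exists>x w h. pivots (Suc k) x w h \<and> reduction (Suc k) x"
proof -
  note I = is_primeD(1)[OF p]
  obtain P M H d c where R: "reduced k x P M H d c"
    using red by (auto simp: reduction_def)
  have P: "\<And>i j. homogeneous d (P i j)"
    and M: "\<And>i j. M i j = (\<Sum>l\<in>UNIV. P i l * generic l j)"
    and M0: "\<And>l i. l < k \<Longrightarrow> mat_vec M (Cvec (x l)) i = 0"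
    and c: "c \<notin> p" and cA: "\<And>i j. c * generic i j = M i j + H i j"
    and rk: "\<And>A. rank (\<chi> i j. sym_eval (H i j) A) \<le> k" and k0: "k = 0 \<Longrightarrow> M = generic"
    using R unfolding reduced_def by blast+
  have Msym: "M i j = M j i" and Hsym: "H i j = H j i" for i j
    using R unfolding reduced_def by blast+
  have "\<exists>a b. M a b \<notin> p"
  proof (rule ccontr)
    assume "\<not> ?thesis"
    then have Mp: "M a b \<in> p" for a b by blast
    have "subst Const (entries H) f \<in> S_ideal r"
    proof (rule subst_entries_in_S_ideal[OF f(1,3,4) Hsym])
      show "(\<chi> i j. sym_eval (H i j) A) = 0 \<or> rank (\<chi> i j. sym_eval (H i j) A) \<le> r - 1" for A
        using rk[of A] k by linarith
    qed
    moreover have "subst Const (\<lambda>e. c * Var e) f - subst Const (entries H) f \<in> p"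
    proof (rule subst_cong[OF I])
      fix e
      have "c * Var e - entries H e = M (fst_index e) (snd_index e)"
        using cA[of "fst_index e" "snd_index e"] by (simp add: entries_def generic_def Upair_index)
      then show "c * Var e - entries H e \<in> p" using Mp by simp
    qed
    ultimately have "subst Const (\<lambda>e. c * Var e) f \<in> p"
      using Sp is_idealD(2)[OF I] by (metis diff_add_cancel subsetD)
    then have "c ^ n * f \<in> p" by (simp add: subst_homogeneous[OF f(3)] subst_Const_Var)
    then show False using c f(2) is_prime_power[OF p] by (auto simp: is_primeD[OF p])
  qed
  then obtain y where y: "quad M (Cvec y) \<notin> p"
    using ex_quad_notin[of p M, OF I Msym] by blast
  let ?y = "Cvec y"
  have My: "mat_vec M z i = (\<Sum>j\<in>UNIV. P i j * mat_vec generic z j)" for z i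
  proof -
    have "mat_vec M z i = (\<Sum>j\<in>UNIV. \<Sum>l\<in>UNIV. P i l * generic l j * z j)"
      by (simp add: mat_vec_def M sum_distrib_right)
    also have "\<dots> = (\<Sum>l\<in>UNIV. \<Sum>j\<in>UNIV. P i l * generic l j * z j)" by (rule sum.swap)
    finally show ?thesis by (simp add: mat_vec_def sum_distrib_left mult.assoc)
  qed
  have homM: "homogeneous (Suc d) (M i j)" for i j
    unfolding M using homogeneous_mult[OF P homogeneous_Var]
    by (intro homogeneous_sum) (simp add: generic_def)
  have homMy: "homogeneous (Suc d) (mat_vec M ?y i)" for i
    unfolding mat_vec_def using homogeneous_mult[OF homM homogeneous_Const]
    by (intro homogeneous_sum) simp
  have homq: "homogeneous (Suc d) (quad M ?y)"
    unfolding quad_def using homogeneous_mult[OF homogeneous_Const homMy]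
    by (intro homogeneous_sum) simp
  define v where "v = (\<lambda>j. \<Sum>i\<in>UNIV. ?y i * P i j)"
  have homv: "homogeneous d (v j)" for j
    unfolding v_def using homogeneous_mult[OF homogeneous_Const P]
    by (intro homogeneous_sum) simp
  have pair_v: "pairing v z = (\<Sum>i\<in>UNIV. ?y i * mat_vec M (Cvec z) i)" for z
  proof -
    have "pairing v z = (\<Sum>j\<in>UNIV. \<Sum>i\<in>UNIV. ?y i * P i j * mat_vec generic (Cvec z) j)"
      by (simp add: pairing_def v_def sum_distrib_right)
    also have "\<dots> = (\<Sum>i\<in>UNIV. \<Sum>j\<in>UNIV. ?y i * P i j * mat_vec generic (Cvec z) j)" by (rule sum.swap)
    finally show ?thesis by (simp add: My sum_distrib_left mult.assoc)
  qed
  have "pivots (Suc k) (x(k := y)) (w(k := v)) (h(k := d))"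
    unfolding pivots_def
  proof (intro conjI impI allI)
    fix l assume l: "l < Suc k"
    show "homogeneous ((h(k := d)) l) ((w(k := v)) l i)" for i
      using l piv homv by (cases "l = k") (auto simp: pivots_def)
    show "pairing ((w(k := v)) l) ((x(k := y)) l) \<notin> p"
      using l piv y by (cases "l = k") (auto simp: pivots_def pair_v quad_def)
    show "pairing ((w(k := v)) l) ((x(k := y)) l') = 0" if "l' < l" for l'
      using l that piv M0 by (cases "l = k") (auto simp: pivots_def pair_v)
  next
    show "quad generic (Cvec ((x(k := y)) 0)) \<notin> p"
      using piv y k0 by (cases "k = 0") (auto simp: pivots_def)
  qed
  moreover have "reduction (Suc k) (x(k := y))"
  proof -
    let ?q = "quad M ?y" and ?u = "mat_vec M ?y"
    let ?P = "\<lambda>i j. ?q * P i j - ?u i * v j" and ?M = "Lagrange M ?y"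
    let ?H = "\<lambda>i j. ?q * H i j + ?u i * ?u j"
    have P': "homogeneous (Suc d + d) (?P i j)" for i j
      by (intro homogeneous_diff homogeneous_mult homq P homMy homv)
    have M': "?M i j = (\<Sum>l\<in>UNIV. ?P i l * generic l j)" for i j
    proof -
      have "(\<Sum>l\<in>UNIV. v l * generic l j) = (\<Sum>l\<in>UNIV. \<Sum>i\<in>UNIV. ?y i * P i l * generic l j)"
        by (simp add: v_def sum_distrib_right)
      also have "\<dots> = (\<Sum>i\<in>UNIV. \<Sum>l\<in>UNIV. ?y i * P i l * generic l j)" by (rule sum.swap)
      also have "\<dots> = (\<Sum>i\<in>UNIV. ?y i * M i j)"
        by (simp add: M sum_distrib_left mult.assoc)
      also have "\<dots> = ?u j" by (simp add: mat_vec_def Msym[of j] mult.commute)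
      finally have "(\<Sum>l\<in>UNIV. v l * generic l j) = ?u j" .
      then show ?thesis
        by (simp add: Lagrange_def left_diff_distrib sum_subtractf mult.assoc M flip: sum_distrib_left)
    qed
    have sym': "?M i j = ?M j i" for i j by (rule Lagrange_sym[OF Msym])
    have ker': "mat_vec ?M (Cvec ((x(k := y)) l)) i = 0" if "l < Suc k" for l i
      using that M0 by (cases "l = k") (auto simp: mat_vec_Lagrange[OF Msym] quad_def)
    have c': "?q * c \<notin> p" using y c by (simp add: is_primeD[OF p])
    have cA': "?q * c * generic i j = ?M i j + ?H i j" for i j
    proof -
      have "?q * c * generic i j = ?q * (M i j + H i j)" by (simp only: mult.assoc cA)
      then show ?thesis by (simp add: Lagrange_def algebra_simps)
    qed
    have H': "?H i j = ?H j i" for i j using Hsym[of i j] by simp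
    have rk': "rank (\<chi> i j. sym_eval (?H i j) A) \<le> Suc k" for A :: "complex^'n^'n"
    proof -
      have "rank (\<chi> i j. sym_eval ?q A * (\<chi> i j. sym_eval (H i j) A) $ i $ j + sym_eval (?u i) A * sym_eval (?u j) A)
          \<le> Suc (rank (\<chi> i j. sym_eval (H i j) A))"
        by (rule rank_add_outer)
      then show ?thesis using rk[of A] by (simp add: ring_mapD[OF ring_map_sym_eval])
    qed
    have "reduced (Suc k) (x(k := y)) ?P ?M ?H (Suc d + d) (?q * c)"
      unfolding reduced_def
      by (intro conjI allI impI) (rule P' M' sym' ker' c' cA' H' rk' | assumption | simp)+
    then show ?thesis unfolding reduction_def by (intro exI)
  qed
  ultimately show ?thesis by blast
qed

lemma ex_pivots: "\<exists>x w h. pivots r x w h"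
proof -
  have "k \<le> r \<Longrightarrow> \<exists>x w h. pivots k x w h \<and> reduction k x" for k
  proof (induction k)
    case 0
    then show ?case using reduction_0 by (auto simp: pivots_def)
  next
    case (Suc k)
    then show ?case using reduction_Suc[of k] by (metis Suc_leD Suc_le_lessD)
  qed
  then show ?thesis by blast
qed

end


section \<open>Counting in a filtered algebra\<close>

locale complex_algebra =
  fixes \<kappa> :: "complex \<Rightarrow> 'b::comm_ring_1"
  assumes \<kappa>: "ring_map \<kappa>"

sublocale complex_algebra \<subseteq> vector_space "\<lambda>c x. \<kappa> c * x"
  by unfold_locales (auto simp: ring_mapD[OF \<kappa>] algebra_simps)

context complex_algebra begin

lemma span_mult:
  assumes x: "x \<in> span S" and y: "y \<in> span S'"
    and prod: "\<And>a b. a \<in> S \<Longrightarrow> b \<in> S' \<Longrightarrow> a * b \<in> span S''"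
  shows "x * y \<in> span S''"
proof -
  have *: "a * y \<in> span S''" if "a \<in> S" for a
    using y
  proof (induction rule: span_induct_alt)
    case (step c z w)
    have "a * (\<kappa> c * z + w) = \<kappa> c * (a * z) + a * w" by (simp add: algebra_simps)
    then show ?case using step prod[OF that] by (simp add: span_add span_scale)
  qed (simp add: span_zero)
  show ?thesis
    using x
  proof (induction rule: span_induct_alt)
    case (step c z w)
    have "(\<kappa> c * z + w) * y = \<kappa> c * (z * y) + w * y" by (simp add: algebra_simps)
    then show ?case using step * by (simp add: span_add span_scale)
  qed (simp add: span_zero)
qed

end

text \<open>The subalgebra generated by the \<open>u i\<close> and \<open>b e\<close>, considered modulo \<open>q\<close>. In the application \<open>b\<close> has the
  entries of \<open>B\<close>, which are to be compared with products of two \<open>u i\<close> and therefore have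
  weight \<open>2\<close>.\<close>

locale filtered_algebra = complex_algebra \<kappa> for \<kappa> :: "complex \<Rightarrow> 'b::comm_ring_1" +
  fixes q :: "'b set" and u :: "'i::finite \<Rightarrow> 'b" and b :: "'v uprod \<Rightarrow> 'b"
  assumes q: "is_ideal q" and fin: "finite (UNIV :: 'v uprod set)"
begin

definition mon :: "('i \<Rightarrow> nat) \<Rightarrow> ('v uprod \<Rightarrow> nat) \<Rightarrow> 'b" where
  "mon \<alpha> \<beta> = (\<Prod>i\<in>UNIV. u i ^ \<alpha> i) * (\<Prod>e\<in>UNIV. b e ^ \<beta> e)"

definition weight :: "('i \<Rightarrow> nat) \<Rightarrow> ('v uprod \<Rightarrow> nat) \<Rightarrow> nat" where
  "weight \<alpha> \<beta> = sum \<alpha> UNIV + 2 * sum \<beta> UNIV"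

text \<open>The bound on the degree in the \<open>b e\<close> is strict, so that \<open>lower t 0\<close> is the zero space.\<close>

definition lower :: "nat \<Rightarrow> nat \<Rightarrow> 'b set" where
  "lower t s = span {mon \<alpha> \<beta> | \<alpha> \<beta>. weight \<alpha> \<beta> \<le> t \<and> sum \<beta> UNIV < s}"

definition fil :: "nat \<Rightarrow> 'b set" where
  "fil t = span ({mon \<alpha> \<beta> | \<alpha> \<beta>. weight \<alpha> \<beta> \<le> t} \<union> q)"

lemma subspace_q: "subspace q"
  by (intro subspaceI) (auto simp: is_idealD[OF q])

lemma mono_mult: "mon \<alpha> \<beta> * mon \<alpha>' \<beta>' = mon (\<lambda>i. \<alpha> i + \<alpha>' i) (\<lambda>e. \<beta> e + \<beta>' e)"
  by (simp add: mon_def power_add prod.distrib algebra_simps)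

lemma weight_add: "weight (\<lambda>i. \<alpha> i + \<alpha>' i) (\<lambda>e. \<beta> e + \<beta>' e) = weight \<alpha> \<beta> + weight \<alpha>' \<beta>'"
  by (simp add: weight_def sum.distrib)

lemma mono_in_lower: "weight \<alpha> \<beta> \<le> t \<Longrightarrow> sum \<beta> UNIV < s \<Longrightarrow> mon \<alpha> \<beta> \<in> lower t s"
  unfolding lower_def by (intro span_base) blast

lemma lower_mult:
  assumes "x \<in> lower t (Suc s)" "y \<in> lower t' s'"
  shows "x * y \<in> lower (t + t') (s + s')"
  using assms unfolding lower_def
proof (rule span_mult)
  fix a c
  assume "a \<in> {mon \<alpha> \<beta> |\<alpha> \<beta>. weight \<alpha> \<beta> \<le> t \<and> sum \<beta> UNIV < Suc s}"
    and "c \<in> {mon \<alpha> \<beta> |\<alpha> \<beta>. weight \<alpha> \<beta> \<le> t' \<and> sum \<beta> UNIV < s'}"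
  then obtain \<alpha> \<beta> \<alpha>' \<beta>' where "a = mon \<alpha> \<beta>" "weight \<alpha> \<beta> \<le> t" "sum \<beta> UNIV \<le> s"
    "c = mon \<alpha>' \<beta>'" "weight \<alpha>' \<beta>' \<le> t'" "sum \<beta>' UNIV < s'" by auto
  then have "a * c = mon (\<lambda>i. \<alpha> i + \<alpha>' i) (\<lambda>e. \<beta> e + \<beta>' e)"
    "weight (\<lambda>i. \<alpha> i + \<alpha>' i) (\<lambda>e. \<beta> e + \<beta>' e) \<le> t + t'"
    "sum (\<lambda>e. \<beta> e + \<beta>' e) UNIV < s + s'"
    by (auto simp: mono_mult weight_add sum.distrib)
  then show "a * c \<in> span {mon \<alpha> \<beta> |\<alpha> \<beta>. weight \<alpha> \<beta> \<le> t + t' \<and> sum \<beta> UNIV < s + s'}"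
    by (intro span_base) blast
qed

lemma lower_mono: "t \<le> t' \<Longrightarrow> s \<le> s' \<Longrightarrow> lower t s \<subseteq> lower t' s'"
  unfolding lower_def by (intro span_mono Collect_mono impI) (elim exE conjE, intro exI conjI, assumption, auto)

lemma u_mono: "u i = mon (\<lambda>j. if j = i then 1 else 0) (\<lambda>e. 0)"
  by (simp add: mon_def if_distrib[of "\<lambda>n. _ ^ n"] cong: if_cong)

lemma b_mono: "b e = mon (\<lambda>j. 0) (\<lambda>e'. if e' = e then 1 else 0)"
  using fin by (simp add: mon_def if_distrib[of "\<lambda>n. _ ^ n"] cong: if_cong)

lemma one_mono: "1 = mon (\<lambda>j. 0) (\<lambda>e. 0)"
  by (simp add: mon_def)

lemma u_in_lower: "u i \<in> lower 1 1"
  by (subst u_mono) (auto intro!: mono_in_lower simp: weight_def)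

lemma b_in_lower: "b e \<in> lower 2 2"
  using fin by (subst b_mono) (auto intro!: mono_in_lower simp: weight_def)

lemma one_in_lower: "1 \<in> lower 0 1"
  by (subst one_mono) (auto intro!: mono_in_lower simp: weight_def)

text \<open>Forms of degree \<open>n\<close> in the \<open>b e\<close> with the same leading part; this relation is compatible with
  products.\<close>

definition congruent_lower :: "nat \<Rightarrow> 'b \<Rightarrow> 'b \<Rightarrow> bool" where
  "congruent_lower n x y \<longleftrightarrow> x \<in> lower (2 * n) (Suc n) \<and> y \<in> lower (2 * n) (Suc n) \<and> x - y \<in> lower (2 * n) n"

lemma congruent_lower_mult:
  assumes "congruent_lower n x y" "congruent_lower n' x' y'"
  shows "congruent_lower (n + n') (x * x') (y * y')"
proof -
  have "x * x' \<in> lower (2 * n + 2 * n') (n + Suc n')" "y * y' \<in> lower (2 * n + 2 * n') (n + Suc n')"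
    using assms by (simp_all only: congruent_lower_def lower_mult)
  moreover have "x' * (x - y) \<in> lower (2 * n' + 2 * n) (n' + n)" "y * (x' - y') \<in> lower (2 * n + 2 * n') (n + n')"
    using assms by (auto simp: congruent_lower_def intro: lower_mult)
  then have "x' * (x - y) + y * (x' - y') \<in> lower (2 * n + 2 * n') (n + n')"
    unfolding lower_def by (simp add: add.commute span_add)
  then have "x * x' - y * y' \<in> lower (2 * n + 2 * n') (n + n')"
    by (simp add: algebra_simps)
  ultimately show ?thesis by (simp add: congruent_lower_def distrib_left)
qed

lemma congruent_lower_1: "congruent_lower 0 1 1"
  using one_in_lower by (simp add: congruent_lower_def lower_def span_zero)

lemma congruent_lower_power: "congruent_lower n x y \<Longrightarrow> congruent_lower (k * n) (x ^ k) (y ^ k)"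
  by (induction k) (auto simp: congruent_lower_1 congruent_lower_mult)

lemma congruent_lower_prod:
  "finite A \<Longrightarrow> (\<And>i. i \<in> A \<Longrightarrow> congruent_lower (n i) (x i) (y i)) \<Longrightarrow>
    congruent_lower (sum n A) (prod x A) (prod y A)"
  by (induction A rule: finite_induct) (auto simp: congruent_lower_1 congruent_lower_mult)

text \<open>In the expansion of the form at \<open>g\<close>, each factor \<open>u i * u j\<close> replaces one of the \<open>b e\<close> and has the
  same weight.\<close>

lemma subst_diff_in_lower:
  assumes f: "homogeneous n f" and g: "\<And>e. \<exists>i j. g e = b e - u i * u j"
  shows "subst \<kappa> b f - subst \<kappa> g f \<in> lower (2 * n) n"
proof -
  have cong: "congruent_lower 1 (b e) (g e)" for e
  proof -
    obtain i j where e: "g e = b e - u i * u j" using g by blast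
    have "u i * u j \<in> lower 2 1" using lower_mult[OF u_in_lower[of i, unfolded One_nat_def] u_in_lower[of j]] by (simp add: numeral_2_eq_2)
    moreover then have "u i * u j \<in> lower 2 2" using lower_mono[of 2 2 1 2] by auto
    ultimately show ?thesis
      using b_in_lower[of e] unfolding congruent_lower_def e
      by (auto simp: lower_def numeral_2_eq_2 intro: span_diff)
  qed
  have "congruent_lower (mon_deg m) (monom_eval b m) (monom_eval g m)" for m
    unfolding mon_deg_def monom_eval_def using congruent_lower_power[OF cong]
    by (intro congruent_lower_prod) auto
  then have "monom_eval b m - monom_eval g m \<in> lower (2 * n) n" if "m \<in> Poly_Mapping.keys f" for m
    using that f unfolding homogeneous_def congruent_lower_def by metis
  then have "(\<Sum>m\<in>Poly_Mapping.keys f. \<kappa> (Poly_Mapping.lookup f m) * (monom_eval b m - monom_eval g m))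
      \<in> lower (2 * n) n"
    unfolding lower_def by (intro span_sum span_scale)
  then show ?thesis by (simp add: subst_def right_diff_distrib sum_subtractf)
qed

lemma fil_mult:
  assumes "x \<in> fil t" "y \<in> fil t'"
  shows "x * y \<in> fil (t + t')"
  using assms unfolding fil_def
proof (rule span_mult)
  fix a c assume a: "a \<in> {mon \<alpha> \<beta> |\<alpha> \<beta>. weight \<alpha> \<beta> \<le> t} \<union> q"
    and c: "c \<in> {mon \<alpha> \<beta> |\<alpha> \<beta>. weight \<alpha> \<beta> \<le> t'} \<union> q"
  show "a * c \<in> span ({mon \<alpha> \<beta> |\<alpha> \<beta>. weight \<alpha> \<beta> \<le> t + t'} \<union> q)"
  proof (cases "a \<in> q \<or> c \<in> q")
    case True
    then have "a * c \<in> q" using is_idealD(3,4)[OF q] by blast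
    then show ?thesis by (intro span_base) blast
  next
    case False
    then obtain \<alpha> \<beta> \<alpha>' \<beta>' where "a = mon \<alpha> \<beta>" "weight \<alpha> \<beta> \<le> t"
      "c = mon \<alpha>' \<beta>'" "weight \<alpha>' \<beta>' \<le> t'" using a c by auto
    then have "a * c = mon (\<lambda>i. \<alpha> i + \<alpha>' i) (\<lambda>e. \<beta> e + \<beta>' e)"
      "weight (\<lambda>i. \<alpha> i + \<alpha>' i) (\<lambda>e. \<beta> e + \<beta>' e) \<le> t + t'"
      by (auto simp: mono_mult weight_add)
    then show ?thesis by (intro span_base) blast
  qed
qed

lemma fil_mono: "t \<le> t' \<Longrightarrow> fil t \<subseteq> fil t'"
  unfolding fil_def by (intro span_mono Un_mono Collect_mono order_refl impI) (elim exE conjE, intro exI conjI, assumption, auto)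

lemma lower_subset_fil: "lower t s \<subseteq> fil t"
  unfolding fil_def lower_def by (intro span_mono) auto

lemma fil_power: "x \<in> fil t \<Longrightarrow> x ^ k \<in> fil (k * t)"
  using lower_subset_fil[of 0 1] one_in_lower by (induction k) (auto intro: fil_mult)

lemma fil_sum: "(\<And>i. i \<in> A \<Longrightarrow> f i \<in> fil t) \<Longrightarrow> sum f A \<in> fil t"
  unfolding fil_def by (intro span_sum)

lemma subst_in_fil:
  assumes "homogeneous n f" shows "subst \<kappa> b f \<in> fil (2 * n)"
proof -
  have "congruent_lower 1 (b e) (b e)" for e
    using b_in_lower by (simp add: congruent_lower_def lower_def span_zero numeral_2_eq_2)
  from congruent_lower_power[OF this]
  have "congruent_lower (mon_deg m) (monom_eval b m) (monom_eval b m)" for m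
    unfolding mon_deg_def monom_eval_def by (intro congruent_lower_prod) simp_all
  then have "monom_eval b m \<in> fil (2 * mon_deg m)" for m
    using lower_subset_fil by (meson congruent_lower_def subsetD)
  then have "monom_eval b m \<in> fil (2 * n)" if "m \<in> Poly_Mapping.keys f" for m
    using that assms unfolding homogeneous_def by metis
  then show ?thesis unfolding subst_def fil_def by (intro span_sum span_scale)
qed

definition reduced_monos :: "('v uprod \<Rightarrow> nat) \<Rightarrow> nat \<Rightarrow> 'b set" where
  "reduced_monos n t = {mon \<alpha> \<beta> | \<alpha> \<beta>. weight \<alpha> \<beta> \<le> t \<and> (\<forall>e. \<beta> e < n e)}"

text \<open>Rewriting \<open>b e ^ n e\<close> lowers the degree in the \<open>b e\<close> without raising the weight, so it terminates with
  bounded exponents of the \<open>b e\<close>. Only the \<open>u i\<close> contribute to the growth.\<close>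

lemma fil_subset_reduced:
  assumes rel: "\<And>e. \<exists>y \<in> lower (2 * n e) (n e). b e ^ n e - y \<in> q"
  shows "fil t \<subseteq> span (reduced_monos n t \<union> q)"
proof -
  have "mon \<alpha> \<beta> \<in> span (reduced_monos n t \<union> q)" if "weight \<alpha> \<beta> \<le> t" for \<alpha> \<beta>
    using that
  proof (induction "sum \<beta> UNIV" arbitrary: \<alpha> \<beta> rule: less_induct)
    case less
    show ?case
    proof (cases "\<forall>e. \<beta> e < n e")
      case True
      then show ?thesis using less.prems by (intro span_base) (auto simp: reduced_monos_def)
    next
      case False
      then obtain e where e: "n e \<le> \<beta> e" by (auto simp: not_less)
      obtain y where y: "y \<in> lower (2 * n e) (n e)" "b e ^ n e - y \<in> q" using rel by blast
      define \<gamma> where "\<gamma> = \<beta>(e := \<beta> e - n e)"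
      have sum\<beta>: "sum \<beta> UNIV = sum \<gamma> UNIV + n e"
        using fin e by (simp add: \<gamma>_def sum.remove[of UNIV e])
      have "(\<Prod>e\<in>UNIV. b e ^ \<beta> e) = b e ^ n e * (\<Prod>e\<in>UNIV. b e ^ \<gamma> e)"
        using fin e by (simp add: \<gamma>_def prod.remove[of UNIV e] flip: power_add mult.assoc)
      then have eq: "mon \<alpha> \<beta> = (b e ^ n e - y) * mon \<alpha> \<gamma> + mon \<alpha> \<gamma> * y"
        by (simp add: mon_def algebra_simps)
      have "mon \<alpha> \<gamma> * y \<in> lower (weight \<alpha> \<gamma> + 2 * n e) (sum \<gamma> UNIV + n e)"
        using y(1) by (intro lower_mult mono_in_lower) auto
      also have "weight \<alpha> \<gamma> + 2 * n e = weight \<alpha> \<beta>" by (simp add: weight_def sum\<beta>)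
      also have "lower (weight \<alpha> \<beta>) (sum \<gamma> UNIV + n e) \<subseteq> span (reduced_monos n t \<union> q)"
        unfolding lower_def sum\<beta>[symmetric]
        using less by (intro span_minimal subspace_span) auto
      finally have "mon \<alpha> \<gamma> * y \<in> span (reduced_monos n t \<union> q)" .
      moreover have "(b e ^ n e - y) * mon \<alpha> \<gamma> \<in> span (reduced_monos n t \<union> q)"
        using is_idealD(4)[OF q y(2)] by (intro span_base) blast
      ultimately show ?thesis unfolding eq by (intro span_add)
    qed
  qed
  then show ?thesis
    unfolding fil_def by (intro span_minimal subspace_span) (auto intro: span_base)
qed

lemma finite_card_reduced_monos:
  "finite (reduced_monos n t)" "card (reduced_monos n t) \<le> (t + 1) ^ CARD('i) * prod n UNIV"
proof -
  let ?A = "PiE (UNIV :: 'i set) (\<lambda>i. {..t})" and ?B = "PiE (UNIV :: 'v uprod set) (\<lambda>e. {..<n e})"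
  have sub: "reduced_monos n t \<subseteq> (\<lambda>(\<alpha>, \<beta>). mon \<alpha> \<beta>) ` (?A \<times> ?B)"
  proof
    fix x assume "x \<in> reduced_monos n t"
    then obtain \<alpha> \<beta> where x: "x = mon \<alpha> \<beta>" "weight \<alpha> \<beta> \<le> t" "\<forall>e. \<beta> e < n e"
      by (auto simp: reduced_monos_def)
    have "\<alpha> i \<le> t" for i
      using x(2) member_le_sum[of i UNIV \<alpha>] by (simp add: weight_def)
    then show "x \<in> (\<lambda>(\<alpha>, \<beta>). mon \<alpha> \<beta>) ` (?A \<times> ?B)" using x by auto
  qed
  have fin': "finite (?A \<times> ?B)" using fin by (intro finite_cartesian_product finite_PiE) auto
  show "finite (reduced_monos n t)" using sub fin' by (rule finite_surj[rotated])
  have "card (reduced_monos n t) \<le> card (?A \<times> ?B)" using sub fin' by (rule surj_card_le[rotated])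
  also have "\<dots> = (t + 1) ^ CARD('i) * prod n UNIV"
    using fin by (simp add: card_cartesian_product card_PiE)
  finally show "card (reduced_monos n t) \<le> (t + 1) ^ CARD('i) * prod n UNIV" .
qed

lemma ex_relation_in_fil:
  assumes rel: "\<And>e. \<exists>y \<in> lower (2 * n e) (n e). b e ^ n e - y \<in> q"
    and X: "finite A" "(t + 1) ^ CARD('i) * prod n UNIV < card A" "\<And>x. x \<in> A \<Longrightarrow> z x \<in> fil t"
  shows "\<exists>c. (\<exists>x\<in>A. c x \<noteq> 0) \<and> (\<Sum>x\<in>A. \<kappa> (c x) * z x) \<in> q"
proof -
  let ?S = "reduced_monos n t"
  have "\<exists>s. s \<in> span ?S \<and> z x - s \<in> q" if "x \<in> A" for x
  proof -
    have "z x \<in> span (?S \<union> q)" using fil_subset_reduced[OF rel] X(3)[OF that] by blast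
    moreover have "span q = q" using subspace_q by simp
    ultimately obtain a c where "z x = a + c" "a \<in> span ?S" "c \<in> q"
      unfolding span_Un by auto
    then show ?thesis by (intro exI[of _ a]) simp
  qed
  then obtain s where s: "\<And>x. x \<in> A \<Longrightarrow> s x \<in> span ?S" "\<And>x. x \<in> A \<Longrightarrow> z x - s x \<in> q" by metis
  have "\<exists>c. (\<exists>x\<in>A. c x \<noteq> 0) \<and> (\<Sum>x\<in>A. \<kappa> (c x) * s x) = 0"
  proof (cases "inj_on s A")
    case True
    have "dependent (s ` A)"
    proof (rule ccontr)
      assume "independent (s ` A)"
      then have "card (s ` A) \<le> card ?S"
        using independent_span_bound[of ?S "s ` A"] finite_card_reduced_monos(1) s(1) by blast
      then show False using X(2) finite_card_reduced_monos(2)[of n t] True by (simp add: card_image)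
    qed
    then obtain c where "\<exists>v\<in>s ` A. c v \<noteq> 0" "(\<Sum>v\<in>s ` A. \<kappa> (c v) * v) = 0"
      using dependent_finite[of "s ` A"] X(1) by auto
    then show ?thesis using True by (intro exI[of _ "c \<circ> s"]) (auto simp: sum.reindex)
  next
    case False
    then obtain x y where xy: "x \<in> A" "y \<in> A" "x \<noteq> y" "s x = s y" by (auto simp: inj_on_def)
    define c where "c = (\<lambda>w. if w = x then 1 else if w = y then -1 else 0 :: complex)"
    have "(\<Sum>w\<in>A. \<kappa> (c w) * s w) = (\<Sum>w\<in>{x, y}. \<kappa> (c w) * s w)"
      using X(1) xy by (intro sum.mono_neutral_right) (auto simp: c_def ring_mapD[OF \<kappa>])
    also have "\<dots> = 0" using xy by (simp add: c_def ring_mapD[OF \<kappa>])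
    finally show ?thesis using xy by (intro exI[of _ c]) (auto simp: c_def)
  qed
  then obtain c where c: "\<exists>x\<in>A. c x \<noteq> 0" "(\<Sum>x\<in>A. \<kappa> (c x) * s x) = 0" by blast
  have "(\<Sum>x\<in>A. \<kappa> (c x) * (z x - s x)) \<in> q" by (intro is_ideal_sum q is_idealD(3) s(2))
  then have "(\<Sum>x\<in>A. \<kappa> (c x) * z x) \<in> q" by (simp add: right_diff_distrib sum_subtractf c(2))
  then show ?thesis using c(1) by blast
qed

end


section \<open>Monomials enumerated by digits\<close>

text \<open>The monomial in \<open>w 0, \<dots>, w (k - 1)\<close> whose exponents are the digits of \<open>\<nu>\<close> in base \<open>m\<close>,
  homogenized by powers of \<open>z\<close>. Numbering the monomials makes them easy to count and turns their degrees
  under Kronecker's substitution into their numbers.\<close>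

primrec radix :: "nat \<Rightarrow> (nat \<Rightarrow> 'a::comm_ring_1) \<Rightarrow> 'a \<Rightarrow> nat \<Rightarrow> nat \<Rightarrow> 'a" where
  "radix m w z 0 \<nu> = 1"
| "radix m w z (Suc k) \<nu> =
     radix m w z k (\<nu> mod m ^ k) * (w k ^ (\<nu> div m ^ k) * z ^ (m - \<nu> div m ^ k))"

lemma radix_digit:
  fixes m :: nat
  assumes "\<nu> < m ^ Suc k"
  shows "\<nu> mod m ^ k < m ^ k" "\<nu> div m ^ k < m"
proof -
  have "0 < m" using assms by (cases m) auto
  then show "\<nu> mod m ^ k < m ^ k" by simp
  show "\<nu> div m ^ k < m" using assms by (simp add: less_mult_imp_div_less)
qed

lemma radix_scale:
  "\<nu> < m ^ k \<Longrightarrow> radix m (\<lambda>i. c * w i) (c * z) k \<nu> = c ^ (k * m) * radix m w z k \<nu>"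
proof (induction k arbitrary: \<nu>)
  case (Suc k)
  define l where "l = \<nu> div m ^ k"
  have l: "l < m" "\<nu> mod m ^ k < m ^ k" using radix_digit[OF Suc.prems] by (auto simp: l_def)
  have "c ^ m = c ^ l * c ^ (m - l)" using l by (simp flip: power_add)
  then show ?case
    using Suc.IH[OF l(2)] by (simp add: power_mult_distrib power_add l_def[symmetric])
qed simp

lemma radix_homogeneous:
  assumes "\<And>i. i < k \<Longrightarrow> homogeneous e (w i)" "homogeneous e z" "\<nu> < m ^ k"
  shows "homogeneous (k * m * e) (radix m w z k \<nu>)"
  using assms
proof (induction k arbitrary: \<nu>)
  case (Suc k)
  define l where "l = \<nu> div m ^ k"
  have l: "l < m" "\<nu> mod m ^ k < m ^ k" using radix_digit[OF Suc.prems(3)] by (auto simp: l_def)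
  have "homogeneous (k * m * e + (l * e + (m - l) * e)) (radix m w z k (\<nu> mod m ^ k) * (w k ^ l * z ^ (m - l)))"
    using l Suc by (intro homogeneous_mult homogeneous_power) auto
  moreover have "l * e + (m - l) * e = m * e" using l by (simp flip: add_mult_distrib)
  then have "k * m * e + (l * e + (m - l) * e) = Suc k * m * e" by (simp add: algebra_simps)
  ultimately show ?case by (simp add: l_def)
qed (simp add: homogeneous_1)

text \<open>Kronecker's substitution: the degree adds up the digits of \<open>\<nu>\<close> with their place values.\<close>

lemma radix_lead_at:
  assumes p: "is_prime p" and "\<And>i. i < k \<Longrightarrow> lead_at p (w i) (m ^ i)" "lead_at p z 0" "\<nu> < m ^ k"
  shows "lead_at p (radix m w z k \<nu>) \<nu>"
  using assms(2-)
proof (induction k arbitrary: \<nu>)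
  case (Suc k)
  define l where "l = \<nu> div m ^ k"
  have l: "l < m" "\<nu> mod m ^ k < m ^ k" using radix_digit[OF Suc.prems(3)] by (auto simp: l_def)
  have "lead_at p (radix m w z k (\<nu> mod m ^ k) * (w k ^ l * z ^ (m - l)))
      (\<nu> mod m ^ k + (l * m ^ k + (m - l) * 0))"
    using l Suc by (intro lead_at_mult[OF p] lead_at_power[OF p]) auto
  moreover have "\<nu> mod m ^ k + (l * m ^ k + (m - l) * 0) = \<nu>" by (simp add: l_def mod_div_mult_eq)
  ultimately show ?case by (simp add: l_def)
qed (simp add: lead_at_1[OF p])

lemma (in filtered_algebra) radix_in_fil:
  assumes "\<And>i. i < k \<Longrightarrow> w i \<in> fil t" "z \<in> fil t" "\<nu> < m ^ k"
  shows "radix m w z k \<nu> \<in> fil (k * m * t)"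
  using assms
proof (induction k arbitrary: \<nu>)
  case 0
  then show ?case using one_in_lower lower_subset_fil by fastforce
next
  case (Suc k)
  define l where "l = \<nu> div m ^ k"
  have l: "l < m" "\<nu> mod m ^ k < m ^ k" using radix_digit[OF Suc.prems(3)] by (auto simp: l_def)
  have "radix m w z k (\<nu> mod m ^ k) * (w k ^ l * z ^ (m - l)) \<in> fil (k * m * t + (l * t + (m - l) * t))"
    using l Suc by (intro fil_mult fil_power) auto
  moreover have "l * t + (m - l) * t = m * t" using l by (simp flip: add_mult_distrib)
  then have "k * m * t + (l * t + (m - l) * t) = Suc k * m * t" by (simp add: algebra_simps)
  ultimately show ?case by (simp add: l_def)
qed

text \<open>In a polynomial relation modulo the smallest prime \<open>P (Suc d)\<close>, cancel the lowest power of the last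
  element \<open>w d\<close>, which is not in that prime. The other terms that contain \<open>w d\<close> lie in \<open>P d\<close>, and what
  remains is a relation between the other elements modulo \<open>P d\<close>.\<close>

lemma radix_independent:
  fixes w :: "nat \<Rightarrow> 'b::comm_ring_1" and \<kappa> :: "complex \<Rightarrow> 'b"
  assumes \<kappa>: "ring_map \<kappa>" and P: "\<And>i. i \<le> d \<Longrightarrow> is_prime (P i)" "\<And>i. i < d \<Longrightarrow> P (Suc i) \<subseteq> P i"
    and z: "z \<notin> P 0" and w: "\<And>i. i < d \<Longrightarrow> w i \<in> P i \<and> w i \<notin> P (Suc i)"
    and sum: "(\<Sum>\<nu><m ^ d. \<kappa> (c \<nu>) * radix m w z d \<nu>) \<in> P d"
  shows "\<forall>\<nu><m ^ d. c \<nu> = 0"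
  using P w sum
proof (induction d arbitrary: c)
  case 0
  have "c 0 = 0"
  proof (rule ccontr)
    assume "c 0 \<noteq> 0"
    have "\<kappa> (1 / c 0) * \<kappa> (c 0) \<in> P 0"
      using 0 is_idealD(3)[OF is_primeD(1)[OF 0(1)[OF order_refl]], of "\<kappa> (c 0)"] by simp
    then show False
      using \<open>c 0 \<noteq> 0\<close> is_primeD(2)[OF 0(1)[OF order_refl]]
      by (simp flip: ring_mapD(3)[OF \<kappa>]) (simp add: ring_mapD[OF \<kappa>])
  qed
  then show ?case by simp
next
  case (Suc d)
  let ?c = "\<lambda>l \<nu>. c (\<nu> + l * m ^ d)"
  define G where "G = (\<lambda>l. \<Sum>\<nu><m ^ d. \<kappa> (?c l \<nu>) * radix m w z d \<nu>)"
  have pr: "is_prime (P d)" "is_prime (P (Suc d))" and sub: "P (Suc d) \<subseteq> P d"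
    and wd: "w d \<in> P d" "w d \<notin> P (Suc d)" using Suc.prems by auto
  have zd: "z \<notin> P d"
  proof -
    have "P i \<subseteq> P 0" if "i \<le> d" for i
      using that
    proof (induction i)
      case (Suc i)
      then show ?case using \<open>\<And>i. i < Suc d \<Longrightarrow> P (Suc i) \<subseteq> P i\<close>[of i] by auto
    qed simp
    then show ?thesis using z by blast
  qed
  have split: "(\<Sum>\<nu><m ^ Suc d. \<kappa> (c \<nu>) * radix m w z (Suc d) \<nu>) = (\<Sum>l<m. w d ^ l * (z ^ (m - l) * G l))"
  proof (cases "m = 0")
    case False
    have "(\<Sum>\<nu><m ^ Suc d. \<kappa> (c \<nu>) * radix m w z (Suc d) \<nu>)
        = (\<Sum>l<m. \<Sum>\<nu>\<in>{l * m ^ d..<l * m ^ d + m ^ d}. \<kappa> (c \<nu>) * radix m w z (Suc d) \<nu>)"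
      by (simp only: power_Suc sum.nat_group)
    also have "\<dots> = (\<Sum>l<m. w d ^ l * (z ^ (m - l) * G l))"
    proof (intro sum.cong refl)
      fix l assume "l \<in> {..<m}"
      have "(\<Sum>\<nu>\<in>{l * m ^ d..<l * m ^ d + m ^ d}. \<kappa> (c \<nu>) * radix m w z (Suc d) \<nu>)
          = (\<Sum>\<nu><m ^ d. \<kappa> (?c l \<nu>) * radix m w z (Suc d) (\<nu> + l * m ^ d))"
        using sum.shift_bounds_nat_ivl[of "\<lambda>\<nu>. \<kappa> (c \<nu>) * radix m w z (Suc d) \<nu>" 0 "l * m ^ d" "m ^ d"]
        by (simp add: add.commute lessThan_atLeast0)
      also have "\<dots> = (\<Sum>\<nu><m ^ d. \<kappa> (?c l \<nu>) * radix m w z d \<nu> * (w d ^ l * z ^ (m - l)))"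
        using False by (intro sum.cong refl) (simp add: mult.assoc)
      finally show "(\<Sum>\<nu>\<in>{l * m ^ d..<l * m ^ d + m ^ d}. \<kappa> (c \<nu>) * radix m w z (Suc d) \<nu>)
          = w d ^ l * (z ^ (m - l) * G l)"
        by (simp add: G_def sum_distrib_left algebra_simps)
    qed
    finally show ?thesis .
  qed simp
  have zero: "\<forall>\<nu><m ^ d. ?c l \<nu> = 0" if "l < m" for l
    using that
  proof (induction l rule: less_induct)
    case (less l)
    have G0: "G l' = 0" if "l' < l" for l'
      using less.IH[OF that] that less.prems by (simp add: G_def ring_mapD[OF \<kappa>])
    have "(\<Sum>k<m. w d ^ k * (z ^ (m - k) * G k)) = (\<Sum>k\<in>{l..<m}. w d ^ k * (z ^ (m - k) * G k))"
      using less.prems by (intro sum.mono_neutral_right) (auto simp: G0 not_le)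
    also have "\<dots> = (\<Sum>k\<in>{l..<m}. w d ^ l * (w d ^ (k - l) * (z ^ (m - k) * G k)))"
      by (intro sum.cong refl) (simp flip: power_add mult.assoc)
    finally have "w d ^ l * (\<Sum>k\<in>{l..<m}. w d ^ (k - l) * (z ^ (m - k) * G k)) \<in> P (Suc d)"
      using Suc.prems(4) by (simp only: split sum_distrib_left)
    then have "(\<Sum>k\<in>{l..<m}. w d ^ (k - l) * (z ^ (m - k) * G k)) \<in> P (Suc d)"
      using wd(2) is_prime_power[OF pr(2), of "w d" l] by (auto simp: is_primeD(3)[OF pr(2)])
    then have "(\<Sum>k\<in>{l..<m}. w d ^ (k - l) * (z ^ (m - k) * G k)) \<in> P d" using sub by blast
    moreover have "(\<Sum>k\<in>{l..<m}. w d ^ (k - l) * (z ^ (m - k) * G k))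
        = z ^ (m - l) * G l + (\<Sum>k\<in>{Suc l..<m}. w d ^ (k - l) * (z ^ (m - k) * G k))"
      using less.prems by (simp add: sum.atLeast_Suc_lessThan)
    moreover have "(\<Sum>k\<in>{Suc l..<m}. w d ^ (k - l) * (z ^ (m - k) * G k)) \<in> P d"
    proof (intro is_ideal_sum is_primeD(1)[OF pr(1)] is_idealD(4)[OF is_primeD(1)[OF pr(1)]])
      fix k assume "k \<in> {Suc l..<m}"
      then obtain i where "k - l = Suc i" by (metis Suc_diff_Suc Suc_le_lessD atLeastLessThan_iff)
      then show "w d ^ (k - l) \<in> P d" using wd(1) by (simp add: is_primeD(3)[OF pr(1)])
    qed
    ultimately have "z ^ (m - l) * G l \<in> P d" by (simp only: is_ideal_add_iff(2)[OF is_primeD(1)[OF pr(1)]])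
    then have "G l \<in> P d" using zd is_prime_power[OF pr(1), of z "m - l"] by (auto simp: is_primeD(3)[OF pr(1)])
    then show ?case unfolding G_def by (intro Suc.IH) (use Suc.prems in auto)
  qed
  show ?case
  proof (intro allI impI)
    fix \<nu> assume \<nu>: "\<nu> < m ^ Suc d"
    from zero[OF radix_digit(2)[OF \<nu>]] radix_digit(1)[OF \<nu>] show "c \<nu> = 0"
      by (metis mod_div_mult_eq)
  qed
qed


section \<open>Chains of closed sets and chains of primes\<close>

lemma Proj_points_iff:
  "p \<in> Proj_points \<longleftrightarrow> is_prime p \<and> graded p \<and> \<not> irrelevant_ideal \<subseteq> p"
  by (auto simp: Proj_points_def is_prime_iff homogeneous_ideal_iff is_primeD(1))

lemma topspace_Proj_top: "topspace Proj_top = Proj_points"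
proof -
  have "V_plus (UNIV :: 'n sym_poly set) = {}"
    using is_primeD(2) by (auto simp: V_plus_def Proj_points_iff)
  moreover have "homogeneous_ideal (UNIV :: 'n sym_poly set)"
    by (auto simp: homogeneous_ideal_iff is_ideal_def graded_def poly_ideal_def)
  ultimately have "openin Proj_top (Proj_points :: 'n sym_poly set set)"
    unfolding openin_Proj_top by (metis Diff_empty)
  moreover have "topspace Proj_top \<subseteq> (Proj_points :: 'n sym_poly set set)"
    using openin_topspace[of Proj_top] unfolding openin_Proj_top by blast
  ultimately show ?thesis using openin_subset by blast
qed

lemma closedin_Proj_top: "closedin Proj_top T \<longleftrightarrow> (\<exists>J. homogeneous_ideal J \<and> T = V_plus J)"
  unfolding closedin_def topspace_Proj_top openin_Proj_top by (auto simp: V_plus_def)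

lemma closedin_vanishing: "closedin Proj_top {p \<in> Proj_points. f \<in> p}"
proof -
  let ?J = "genideal sym_poly_ring (range (\<lambda>d. component d f))"
  have "homogeneous_ideal ?J"
    by (intro homogeneous_genideal) (use homogeneous_component in blast)
  moreover have "f \<in> p \<longleftrightarrow> range (\<lambda>d. component d f) \<subseteq> p" if "p \<in> Proj_points" for p
    using that graded_iff[of p f] by (auto simp: Proj_points_iff is_primeD(1) poly_ideal_def)
  then have "{p \<in> Proj_points. f \<in> p} = V_plus ?J"
    unfolding V_plus_genideal by blast
  ultimately show ?thesis unfolding closedin_Proj_top by blast
qed

text \<open>If \<open>f g\<close> vanishes on \<open>Z\<close>, then \<open>Z\<close> is the union of the two closed sets where \<open>f\<close> and \<open>g\<close> vanish.\<close>

lemma irreducible_closed_prime: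
  assumes irr: "irreducible_closed (subtopology Proj_top (V_plus I)) Z"
  shows "is_prime (\<Inter>Z)" "graded (\<Inter>Z)" "I \<subseteq> \<Inter>Z" "\<not> irrelevant_ideal \<subseteq> \<Inter>Z"
proof -
  let ?T = "subtopology Proj_top (V_plus I)"
  have Z: "closedin ?T Z" "Z \<noteq> {}"
    and split: "\<And>A B. closedin ?T A \<Longrightarrow> closedin ?T B \<Longrightarrow> Z = A \<union> B \<Longrightarrow> Z = A \<or> Z = B"
    using irr by (auto simp: irreducible_closed_def)
  have sub: "Z \<subseteq> V_plus I" using closedin_subset[OF Z(1)] by simp
  then have pts: "\<And>p. p \<in> Z \<Longrightarrow> is_prime p \<and> graded p \<and> \<not> irrelevant_ideal \<subseteq> p \<and> I \<subseteq> p"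
    by (auto simp: V_plus_def Proj_points_iff)
  have cl: "closedin ?T (Z \<inter> {p. f \<in> p})" for f
  proof -
    have "closedin ?T (V_plus I \<inter> {p \<in> Proj_points. f \<in> p})"
      using closedin_vanishing by (subst Int_commute) (auto simp: closedin_subtopology)
    then have "closedin ?T (Z \<inter> (V_plus I \<inter> {p \<in> Proj_points. f \<in> p}))"
      using Z(1) by (rule closedin_Int[rotated])
    moreover have "Z \<inter> (V_plus I \<inter> {p \<in> Proj_points. f \<in> p}) = Z \<inter> {p. f \<in> p}"
      using sub by (auto simp: V_plus_def)
    ultimately show ?thesis by simp
  qed
  show "is_prime (\<Inter>Z)"
    unfolding is_prime_def
  proof (intro conjI allI impI)
    show "is_ideal (\<Inter>Z)"
      by (subst is_ideal_def) (use pts in \<open>auto intro: is_idealD dest!: is_primeD(1)\<close>)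
    show "1 \<notin> \<Inter>Z" using Z(2) pts is_primeD(2) by blast
    fix f g assume fg: "f * g \<in> \<Inter>Z"
    have "Z = (Z \<inter> {p. f \<in> p}) \<union> (Z \<inter> {p. g \<in> p})"
      using fg pts is_primeD(3) by blast
    then have "Z = Z \<inter> {p. f \<in> p} \<or> Z = Z \<inter> {p. g \<in> p}" by (rule split[OF cl cl])
    then show "f \<in> \<Inter>Z \<or> g \<in> \<Inter>Z" by blast
  qed
  show "graded (\<Inter>Z)" using pts by (auto simp: graded_def poly_ideal_def)
  show "I \<subseteq> \<Inter>Z" using pts by blast
  show "\<not> irrelevant_ideal \<subseteq> \<Inter>Z" using pts Z(2) by blast
qed

text \<open>The intersection \<open>\<Inter>Z\<close> is the ideal of \<open>Z\<close>, and a closed set is determined by its ideal.\<close>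

lemma Inter_psubset:
  assumes "irreducible_closed (subtopology Proj_top (V_plus I)) Z" "Z \<subset> Z'" "Z' \<subseteq> Proj_points"
  shows "\<Inter>Z' \<subset> \<Inter>Z"
proof -
  obtain T where "closedin Proj_top T" "Z = T \<inter> V_plus I"
    using assms(1) by (auto simp: irreducible_closed_def closedin_subtopology)
  then obtain J where J: "Z = V_plus J \<inter> V_plus I" by (auto simp: closedin_Proj_top)
  have "Z' \<subseteq> Z" if "\<Inter>Z \<subseteq> \<Inter>Z'"
  proof
    fix p assume "p \<in> Z'"
    then have "\<Inter>Z \<subseteq> p" "p \<in> Proj_points" using that assms(3) by auto
    moreover have "J \<subseteq> \<Inter>Z" "I \<subseteq> \<Inter>Z" using J by (auto simp: V_plus_def)
    ultimately show "p \<in> Z" unfolding J V_plus_def by blast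
  qed
  then show ?thesis using assms(2) by blast
qed

lemma ex_Var_notin:
  assumes "is_ideal p" "\<not> irrelevant_ideal \<subseteq> p"
  shows "\<exists>e. Var e \<notin> p"
proof (rule ccontr)
  assume "\<not> ?thesis"
  then have V: "Var e \<in> p" for e by blast
  have "f \<in> p" if "f \<in> irrelevant_ideal" for f
  proof -
    have "Poly_Mapping.single m (Poly_Mapping.lookup f m) \<in> p" if "m \<in> Poly_Mapping.keys f" for m
    proof -
      have "m \<noteq> 0" using that \<open>f \<in> irrelevant_ideal\<close> by (auto simp: irrelevant_ideal_def in_keys_iff)
      then obtain e where e: "e \<in> Poly_Mapping.keys m" by (metis keys_eq_empty all_not_in_conv)
      then obtain k where k: "Poly_Mapping.lookup m e = Suc k" by (auto simp: in_keys_iff gr0_conv_Suc)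
      have "monom_eval Var m \<in> p"
        unfolding monom_eval_def prod.remove[OF finite_keys e] k
        using V assms(1) by (simp add: is_idealD)
      then have "Const (Poly_Mapping.lookup f m) * monom_eval Var m \<in> p"
        by (rule is_idealD(3)[OF assms(1)])
      then show ?thesis by (simp add: monom_Var Const_def mult_single)
    qed
    then have "(\<Sum>m\<in>Poly_Mapping.keys f. Poly_Mapping.single m (Poly_Mapping.lookup f m)) \<in> p"
      by (intro is_ideal_sum assms(1))
    then show ?thesis by (simp add: sum_single)
  qed
  then show False using assms(2) by blast
qed

lemma ex_homogeneous_separating:
  assumes "is_ideal p" "is_ideal q" "graded p" "graded q" "q \<subset> p"
  shows "\<exists>y d. homogeneous d y \<and> y \<in> p \<and> y \<notin> q"
proof -
  obtain f where "f \<in> p" "f \<notin> q" using assms(5) by blast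
  then obtain d where "component d f \<notin> q" "component d f \<in> p"
    using graded_iff[OF assms(2,4), of f] assms(3) by (auto simp: graded_def poly_ideal_def)
  then show ?thesis using homogeneous_component by blast
qed

text \<open>If no power of the variable were in the sum of the ideals, some prime would contain the sum and avoid
  the variable, and the largest homogeneous ideal inside this prime would be a common
  point.\<close>

lemma ex_power_in_sum:
  assumes I: "homogeneous_ideal I" and J: "homogeneous_ideal J" and disj: "V_plus I \<inter> V_plus J = {}"
  shows "\<exists>n j. 0 < n \<and> j \<in> J \<and> homogeneous n j \<and> Var e ^ n - j \<in> I"
proof -
  note I' = I[unfolded homogeneous_ideal_iff] and J' = J[unfolded homogeneous_ideal_iff]
  let ?K = "{x + y | x y. x \<in> I \<and> y \<in> J}"
  have K: "is_ideal ?K"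
    unfolding is_ideal_def
  proof (intro conjI ballI allI)
    have "0 + 0 \<in> ?K" using I' J' is_idealD(1) by blast
    then show "0 \<in> ?K" by simp
    fix x y assume "x \<in> ?K" "y \<in> ?K"
    then obtain a b a' b' where "x = a + b" "y = a' + b'" "a \<in> I" "a' \<in> I" "b \<in> J" "b' \<in> J" by blast
    then have "x + y = (a + a') + (b + b')" "a + a' \<in> I" "b + b' \<in> J"
      using I' J' by (auto simp: is_idealD)
    then show "x + y \<in> ?K" by blast
  next
    fix s x assume "x \<in> ?K"
    then obtain a b where "x = a + b" "a \<in> I" "b \<in> J" by blast
    then have "s * x = s * a + s * b" "s * a \<in> I" "s * b \<in> J"
      using I' J' by (auto simp: is_idealD distrib_left)
    then show "s * x \<in> ?K" by blast
  qed
  have IK: "I \<subseteq> ?K" and JK: "J \<subseteq> ?K"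
    using is_idealD(1)[of I] is_idealD(1)[of J] I' J' by (force, force)
  have "\<exists>n. Var e ^ n \<in> ?K"
  proof (rule ccontr)
    assume "\<not> ?thesis"
    then have "Var e ^ n \<notin> ?K" for n by blast
    from ex_prime_avoiding[OF K this]
    obtain p where p: "is_prime p" "?K \<subseteq> p" "Var e \<notin> p" .
    let ?p = "{f. grading f \<in> poly_ideal p}"
    have "is_prime ?p" by (intro is_prime_vimage ring_map_grading is_prime_poly_ideal p)
    moreover have "graded ?p"
      using is_idealD(1)[OF is_primeD(1)[OF p(1)]]
      by (auto simp: graded_def poly_ideal_def component_homogeneous[OF homogeneous_component])
    moreover have Ve: "Var e \<notin> ?p"
      using p(3) by (auto simp: poly_ideal_def component_homogeneous[OF homogeneous_Var])
    moreover have "Var e \<in> irrelevant_ideal"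
      by (auto simp: irrelevant_ideal_def Var_def lookup_single when_def) (metis keys_single keys_zero empty_not_insert nat.simps(3))
    ultimately have "?p \<in> Proj_points" unfolding Proj_points_iff by blast
    moreover have "I \<subseteq> p" "J \<subseteq> p" using IK JK p(2) by (auto elim: order_trans)
    then have "I \<subseteq> ?p" "J \<subseteq> ?p" using I' J' by (auto simp: graded_def poly_ideal_def)
    ultimately show False using disj by (auto simp: V_plus_def)
  qed
  then obtain n where "Var e ^ n \<in> ?K" by blast
  then have "Var e * Var e ^ n \<in> ?K" by (rule is_idealD(3)[OF K])
  then obtain i j where ij: "Var e ^ Suc n = i + j" "i \<in> I" "j \<in> J" by auto
  let ?j = "component (Suc n) j"
  have "homogeneous (Suc n) (Var e ^ Suc n)"
    using homogeneous_power[OF homogeneous_Var, of "Suc n" e] by simp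
  then have "Var e ^ Suc n = component (Suc n) (Var e ^ Suc n)" by (simp add: component_homogeneous)
  also have "\<dots> = component (Suc n) i + ?j" by (simp only: ij(1) ring_mapD(2)[OF ring_map_grading] coeff_add)
  finally have "Var e ^ Suc n - ?j = component (Suc n) i" by simp
  moreover have "component (Suc n) i \<in> I" "?j \<in> J"
    using I' J' ij by (auto simp: graded_def poly_ideal_def)
  ultimately show ?thesis using homogeneous_component by (intro exI[of _ "Suc n"] exI[of _ ?j]) auto
qed


section \<open>The dimension bound\<close>

lemma coeff_sum_monom:
  assumes "1 < (m :: nat)" "i < k"
  shows "coeff (\<Sum>i<k. Polynomial.monom (v i) (m ^ i)) (m ^ i) = v i"
proof -
  have "coeff (\<Sum>i<k. Polynomial.monom (v i) (m ^ i)) (m ^ i) = (\<Sum>i'<k. if i' = i then v i' else 0)"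
    using assms by (simp add: coeff_sum coeff_monom)
  then show ?thesis using assms by simp
qed

lemma subst_scaled_Var:
  assumes "homogeneous n f"
  shows "subst (\<lambda>c. [:Const c:]) (\<lambda>e. c * [:Var e:]) f = c ^ n * [:f:]"
proof -
  have "subst (\<lambda>c. [:Const c:]) (\<lambda>e. [:Var e:]) f = [:f:]"
    using subst_hom[OF ring_map_pConst ring_map_Const, of Var f] by (simp add: subst_Const_Var)
  then show ?thesis by (simp only: subst_homogeneous[OF assms])
qed

text \<open>With exponents below \<open>m\<close> there are \<open>m ^ (d + r)\<close> monomials in the \<open>d + r\<close> independent elements, but
  the space that contains them has dimension \<open>O(m ^ CARD('n))\<close>.\<close>

lemma chain_length_le:
  fixes I :: "'n::finite sym_poly set" and P :: "nat \<Rightarrow> 'n sym_poly set"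
  assumes r: "1 \<le> r" and I: "homogeneous_ideal I" and SI: "S_ideal r \<subseteq> I"
    and disj: "V_plus I \<inter> V_plus (S_ideal (r - 1)) = {}"
    and P: "\<And>i. i \<le> d \<Longrightarrow> is_prime (P i)" "\<And>i. i \<le> d \<Longrightarrow> graded (P i)" "\<And>i. i \<le> d \<Longrightarrow> I \<subseteq> P i"
    and rel: "\<not> irrelevant_ideal \<subseteq> P 0" and chain: "\<And>i. i < d \<Longrightarrow> P (Suc i) \<subset> P i"
  shows "d + r \<le> CARD('n)"
proof (rule ccontr)
  assume "\<not> ?thesis"
  then have less: "CARD('n) < d + r" by simp
  let ?p = "P d"
  note p = P(1)[OF order_refl] note Ip = is_primeD(1)[OF p]
  have Sp: "S_ideal r \<subseteq> ?p" using SI P(3)[OF order_refl] by blast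
  obtain e0 where "Var e0 \<notin> P 0" using ex_Var_notin[OF _ rel] P(1) is_primeD(1) by blast
  moreover have "P i \<subseteq> P 0" if "i \<le> d" for i
    using that
  proof (induction i)
    case (Suc i)
    then show ?case using chain[of i] by auto
  qed simp
  ultimately have a: "Var e0 ^ k \<notin> P i" if "i \<le> d" for i k
    using that is_prime_power[OF P(1)[OF that]] by blast
  have "homogeneous_ideal (S_ideal (r - 1) :: 'n sym_poly set)"
    by (simp add: homogeneous_ideal_iff is_ideal_S_ideal graded_S_ideal)
  then have "\<forall>e. \<exists>n j. 0 < n \<and> j \<in> S_ideal (r - 1) \<and> homogeneous n j \<and> Var e ^ n - j \<in> I"
    using ex_power_in_sum[OF I _ disj] by blast
  then obtain n j where n: "\<And>e. 0 < n e" and j: "\<And>e. j e \<in> S_ideal (r - 1)"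
      "\<And>e. homogeneous (n e) (j e)" "\<And>e. Var e ^ n e - j e \<in> I"
    by metis
  have "j e0 \<notin> ?p"
  proof
    assume "j e0 \<in> ?p"
    moreover have "Var e0 ^ n e0 - j e0 \<in> ?p" using j(3) P(3)[OF order_refl] by blast
    ultimately have "(Var e0 ^ n e0 - j e0) + j e0 \<in> ?p" by (intro is_idealD(2)[OF Ip])
    then show False using a[OF order_refl] by simp
  qed
  then interpret pivot_setup ?p r "n e0" "j e0"
    using p Sp r j n by unfold_locales auto
  obtain x w h where "pivots r x w h" using ex_pivots by blast
  then have w: "\<And>l i. l < r \<Longrightarrow> homogeneous (h l) (w l i)" "\<And>l. l < r \<Longrightarrow> pairing (w l) (x l) \<notin> ?p"
      "\<And>l l'. l < r \<Longrightarrow> l' < l \<Longrightarrow> pairing (w l) (x l') = 0"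
    and x0: "quad generic (Cvec (x 0)) \<notin> ?p"
    using r by (auto simp: pivots_def)
  have "\<exists>y g. i < d \<longrightarrow> homogeneous g y \<and> y \<in> P i \<and> y \<notin> P (Suc i)" for i
  proof (cases "i < d")
    case True
    then show ?thesis
      using ex_homogeneous_separating[OF is_primeD(1)[OF P(1)] is_primeD(1)[OF P(1)] P(2) P(2) chain, of i]
      by auto
  qed simp
  then obtain y g where y: "\<And>i. i < d \<Longrightarrow> homogeneous (g i) (y i) \<and> y i \<in> P i \<and> y i \<notin> P (Suc i)"
    by metis

  \<comment> \<open>Powers of a variable outside all the primes bring all forms to the same degree \<open>E\<close>; then each
    of them is multiplied by the same power of \<open>c\<close> when \<open>A\<close> is replaced by \<open>B = c A\<close>.\<close>
  define E where "E = sum g {..<d} + sum h {..<r}"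
  define z where "z = Var e0 ^ E"
  define y' where "y' = (\<lambda>i. Var e0 ^ (E - g i) * y i)"
  define w' where "w' = (\<lambda>l i. Var e0 ^ (E - h l) * w l i)"
  have gE: "g i \<le> E" if "i < d" for i
    using member_le_sum[of i "{..<d}" g] that by (simp add: E_def)
  have hE: "h l \<le> E" if "l < r" for l
    using member_le_sum[of l "{..<r}" h] that by (simp add: E_def)
  have Vk: "homogeneous k (Var e0 ^ k)" for k
    using homogeneous_power[OF homogeneous_Var, of k e0] by simp
  have hom_z: "homogeneous E z" by (simp add: z_def Vk)
  have hom_y: "homogeneous E (y' i)" if "i < d" for i
    using homogeneous_mult[OF Vk, of "g i" "y i" "E - g i"] y[OF that] gE[OF that] by (simp add: y'_def)
  have hom_w: "homogeneous E (w' l i)" if "l < r" for l i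
    using homogeneous_mult[OF Vk w(1)[OF that], of "E - h l"] hE[OF that] by (simp add: w'_def)
  have y'P: "y' i \<in> P i \<and> y' i \<notin> P (Suc i)" if "i < d" for i
    using y[OF that] a[of "Suc i"] that P(1)[of i] P(1)[of "Suc i"] by (auto simp: y'_def is_primeD)

  \<comment> \<open>The elements \<open>Z\<close> below have weight at most \<open>t\<close>, a multiple of \<open>m\<close>, and \<open>m\<close> exceeds the constant
    factor in the upper bound for the number of monomials of this weight.\<close>
  define K where "K = prod n UNIV"
  define L where "L = (2 * E + 1) * (d + r) + 1"
  define m where "m = L ^ CARD('n) * K + 1"
  define t where "t = (2 * E + 1) * (d + r) * m"
  have fin: "finite (UNIV :: 'n uprod set)" by simp
  have "0 < K" using n fin by (auto simp: K_def intro!: prod_pos)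
  then have m: "1 < m" by (simp add: m_def L_def)
  have card_less: "(t + 1) ^ CARD('n) * K < m ^ (r + d)"
  proof -
    have "t + 1 \<le> L * m" using m by (simp add: t_def L_def)
    then have "(t + 1) ^ CARD('n) * K \<le> (L * m) ^ CARD('n) * K" by (intro mult_le_mono1 power_mono) auto
    also have "\<dots> = (L ^ CARD('n) * K) * m ^ CARD('n)" by (simp add: power_mult_distrib)
    also have "\<dots> < m * m ^ CARD('n)" using m by (simp add: m_def)
    also have "\<dots> = m ^ Suc CARD('n)" by simp
    also have "\<dots> \<le> m ^ (r + d)" using less m by (intro power_increasing) auto
    finally show ?thesis .
  qed

  define \<kappa> where "\<kappa> = (\<lambda>c. [:Const c:] :: 'n sym_poly poly)"
  have \<kappa>: "ring_map \<kappa>" unfolding \<kappa>_def by (rule ring_map_CC)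
  define q where "q = poly_ideal ?p"
  have q: "is_prime q" unfolding q_def by (rule is_prime_poly_ideal[OF p])
  \<comment> \<open>The pivots are used in reverse order along the curve \<open>\<xi>\<close>: the pairing of the row \<open>w l\<close> with \<open>x l'\<close>
    is zero for \<open>l' < l\<close>, and these terms must be the ones of higher degree.\<close>
  define A where "A = (\<lambda>i j :: 'n. [:generic i j:])"
  define \<xi> where "\<xi> = (\<lambda>j. \<Sum>i<r. Polynomial.monom (Const (x (r - 1 - i) j) :: 'n sym_poly) (m ^ i))"
  define u where "u = mat_vec A \<xi>"
  define c where "c = quad A \<xi>"
  define B where "B = (\<lambda>e. c * [:Var e:])"
  have u_eq: "u k = (\<Sum>i<r. Polynomial.monom (mat_vec generic (Cvec (x (r - 1 - i))) k) (m ^ i))" for k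
  proof -
    have "u k = (\<Sum>j\<in>UNIV. \<Sum>i<r. Polynomial.monom (generic k j * Const (x (r - 1 - i) j)) (m ^ i))"
      by (simp add: u_def mat_vec_def A_def \<xi>_def sum_distrib_left smult_monom)
    also have "\<dots> = (\<Sum>i<r. \<Sum>j\<in>UNIV. Polynomial.monom (generic k j * Const (x (r - 1 - i) j)) (m ^ i))"
      by (rule sum.swap)
    also have "\<dots> = (\<Sum>i<r. Polynomial.monom (mat_vec generic (Cvec (x (r - 1 - i))) k) (m ^ i))"
      by (simp add: mat_vec_def monom_sum)
    finally show ?thesis .
  qed

  have c: "c \<notin> q"
  proof -
    \<comment> \<open>The top coefficient of \<open>c\<close> is the value of the generic form at the first vector.\<close>
    have c_eq: "c = (\<Sum>k\<in>UNIV. \<Sum>i<r. \<Sum>i'<r. Polynomial.monom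
        (Const (x (r - 1 - i) k) * mat_vec generic (Cvec (x (r - 1 - i'))) k) (m ^ i + m ^ i'))"
      unfolding c_def quad_def u_def[symmetric] u_eq unfolding \<xi>_def by (simp add: sum_product mult_monom)
    have "coeff c (m ^ (r - 1) + m ^ (r - 1)) = (\<Sum>k\<in>UNIV. \<Sum>i<r. \<Sum>i'<r. if i' = r - 1 then if i = r - 1
        then Const (x (r - 1 - i) k) * mat_vec generic (Cvec (x (r - 1 - i'))) k else 0 else 0)"
      unfolding c_eq coeff_sum coeff_monom
    proof (intro sum.cong refl)
      fix k i i' assume "i \<in> {..<r}" "i' \<in> {..<r}"
      then have "m ^ i \<le> m ^ (r - 1)" "m ^ i' \<le> m ^ (r - 1)" using m by (auto intro!: power_increasing)
      then have "m ^ i + m ^ i' = m ^ (r - 1) + m ^ (r - 1) \<longleftrightarrow> m ^ i = m ^ (r - 1) \<and> m ^ i' = m ^ (r - 1)"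
        by linarith
      then have "m ^ i + m ^ i' = m ^ (r - 1) + m ^ (r - 1) \<longleftrightarrow> i = r - 1 \<and> i' = r - 1"
        using m by simp
      then show "(if m ^ i + m ^ i' = m ^ (r - 1) + m ^ (r - 1)
          then Const (x (r - 1 - i) k) * mat_vec generic (Cvec (x (r - 1 - i'))) k else 0)
        = (if i' = r - 1 then if i = r - 1
          then Const (x (r - 1 - i) k) * mat_vec generic (Cvec (x (r - 1 - i'))) k else 0 else 0)"
        by simp
    qed
    also have "\<dots> = quad generic (Cvec (x 0))" using r by (simp add: quad_def)
    finally have "coeff c (m ^ (r - 1) + m ^ (r - 1)) \<notin> ?p" using x0 by (simp only: not_False_eq_True)
    then show ?thesis unfolding q_def poly_ideal_def by blast
  qed

  interpret T: filtered_algebra \<kappa> q u B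
    using \<kappa> fin is_primeD(1)[OF q] by unfold_locales auto
  have B_hom: "subst \<kappa> B f = c ^ k * [:f:]" if "homogeneous k f" for k f
    unfolding \<kappa>_def B_def by (rule subst_scaled_Var[OF that])
  have relation: "\<exists>s \<in> T.lower (2 * n e) (n e). B e ^ n e - s \<in> q" for e
  proof
    let ?g = "entries (Lagrange A \<xi>)"
    have "?g e' = B e' - u (fst_index e') * u (snd_index e')" for e'
      by (simp add: entries_def Lagrange_def B_def c_def u_def A_def generic_def Upair_index)
    then show "subst \<kappa> B (j e) - subst \<kappa> ?g (j e) \<in> T.lower (2 * n e) (n e)"
      by (intro T.subst_diff_in_lower j(2)) blast
    have "poly (\<xi> k) (Const s) = Const (\<Sum>i<r. x (r - 1 - i) k * s ^ (m ^ i))" for k s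
      by (simp add: \<xi>_def poly_sum poly_monom ring_mapD[OF ring_map_Const] ring_map_sum[OF ring_map_Const])
    then have "subst \<kappa> ?g (j e) \<in> poly_ideal (S_ideal r)"
      unfolding \<kappa>_def A_def by (rule subst_Lagrange_curve_in_S_ideal[OF j(1,2) n])
    then have g: "subst \<kappa> ?g (j e) \<in> q" using Sp by (auto simp: q_def poly_ideal_def)
    have "B e ^ n e = c ^ n e * [:Var e ^ n e:]"
      by (simp only: B_def power_mult_distrib ring_mapD(7)[OF ring_map_pConst])
    then have "B e ^ n e - subst \<kappa> B (j e) = c ^ n e * [:Var e ^ n e - j e:]"
      by (simp only: B_hom[OF j(2)] right_diff_distrib ring_mapD(6)[OF ring_map_pConst])
    moreover have "[:Var e ^ n e - j e:] \<in> q"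
      using j(3)[of e] P(3)[OF order_refl] is_idealD(1)[OF Ip]
      by (auto simp: q_def poly_ideal_def coeff_pCons split: nat.split)
    ultimately have "B e ^ n e - subst \<kappa> B (j e) \<in> q"
      by (simp only: is_idealD(3)[OF is_primeD(1)[OF q]])
    then have "(B e ^ n e - subst \<kappa> B (j e)) + subst \<kappa> ?g (j e) \<in> q"
      using g by (rule is_idealD(2)[OF is_primeD(1)[OF q]])
    then show "B e ^ n e - (subst \<kappa> B (j e) - subst \<kappa> ?g (j e)) \<in> q" by (simp add: algebra_simps)
  qed

  \<comment> \<open>\<open>\<omega> i\<close> has degree \<open>m ^ i\<close> modulo the prime, as Kronecker's substitution requires.\<close>
  define \<omega> where "\<omega> = (\<lambda>i. \<Sum>k\<in>UNIV. [:w' (r - 1 - i) k:] * u k)"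
  have lead: "lead_at ?p (\<omega> i) (m ^ i)" if i: "i < r" for i
  proof -
    let ?v = "\<lambda>i'. Var e0 ^ (E - h (r - 1 - i)) * pairing (w (r - 1 - i)) (x (r - 1 - i'))"
    have "\<omega> i = (\<Sum>k\<in>UNIV. \<Sum>i'<r. Polynomial.monom
        (w' (r - 1 - i) k * mat_vec generic (Cvec (x (r - 1 - i'))) k) (m ^ i'))"
      unfolding \<omega>_def u_eq sum_distrib_left by (simp add: smult_monom)
    also have "\<dots> = (\<Sum>i'<r. \<Sum>k\<in>UNIV. Polynomial.monom
        (w' (r - 1 - i) k * mat_vec generic (Cvec (x (r - 1 - i'))) k) (m ^ i'))"
      by (rule sum.swap)
    also have "\<dots> = (\<Sum>i'<r. Polynomial.monom (?v i') (m ^ i'))"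
      by (simp add: w'_def pairing_def sum_distrib_left mult.assoc monom_sum)
    finally have \<omega>i: "\<omega> i = (\<Sum>i'<r. Polynomial.monom (?v i') (m ^ i'))" .
    have "coeff (\<omega> i) (m ^ i) \<notin> ?p"
      unfolding \<omega>i coeff_sum_monom[OF m i] using w(2)[of "r - 1 - i"] i a[OF order_refl]
      by (auto simp: is_primeD[OF p])
    moreover have "coeff (\<omega> i) k = 0" if "m ^ i < k" for k
      unfolding \<omega>i coeff_sum
    proof (intro sum.neutral ballI)
      fix i' assume i': "i' \<in> {..<r}"
      show "coeff (Polynomial.monom (?v i') (m ^ i')) k = 0"
      proof (cases "k = m ^ i'")
        case True
        then have "i < i'" using that m by simp
        then show ?thesis using w(3)[of "r - 1 - i" "r - 1 - i'"] i i' by simp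
      qed (simp add: coeff_monom)
    qed
    ultimately show ?thesis using is_idealD(1)[OF Ip] by (simp add: lead_at_def)
  qed
  have zP: "z \<notin> P i" if "i \<le> d" for i using a[OF that] by (simp add: z_def)

  \<comment> \<open>The monomials in the \<open>y' i\<close> and in the \<open>\<omega> i\<close>, multiplied by the power \<open>M\<close> of \<open>c\<close> that turns them into
    polynomials in \<open>u\<close> and \<open>B\<close>.\<close>
  define Z where "Z = (\<lambda>(\<nu>, \<mu>). subst \<kappa> B (radix m y' z d \<mu>) *
    radix m (\<lambda>i. \<Sum>k\<in>UNIV. subst \<kappa> B (w' (r - 1 - i) k) * u k) (subst \<kappa> B z) r \<nu>)"
  define S where "S = {..<m ^ r} \<times> {..<m ^ d}"
  have Z_fil: "Z s \<in> T.fil t" if sS: "s \<in> S" for s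
  proof -
    obtain \<nu> \<mu> where s: "s = (\<nu>, \<mu>)" "\<nu> < m ^ r" "\<mu> < m ^ d" using sS by (auto simp: S_def)
    have 1: "subst \<kappa> B (radix m y' z d \<mu>) \<in> T.fil (2 * (d * m * E))"
      using s hom_y hom_z by (intro T.subst_in_fil radix_homogeneous) auto
    have "subst \<kappa> B (w' (r - 1 - i) k) * u k \<in> T.fil (2 * E + 1)" if "i < r" for i k
      using that T.u_in_lower T.lower_subset_fil by (intro T.fil_mult T.subst_in_fil hom_w) (simp, blast)
    moreover have "subst \<kappa> B z \<in> T.fil (2 * E + 1)"
      using T.subst_in_fil[OF hom_z] T.fil_mono[of "2 * E" "2 * E + 1"] by auto
    ultimately have "radix m (\<lambda>i. \<Sum>k\<in>UNIV. subst \<kappa> B (w' (r - 1 - i) k) * u k) (subst \<kappa> B z) r \<nu>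
        \<in> T.fil (r * m * (2 * E + 1))"
      using s by (intro T.radix_in_fil T.fil_sum) auto
    then have "Z s \<in> T.fil (2 * (d * m * E) + r * m * (2 * E + 1))"
      using 1 by (simp add: Z_def s T.fil_mult)
    moreover have "2 * (d * m * E) + r * m * (2 * E + 1) \<le> t" by (simp add: t_def algebra_simps)
    ultimately show ?thesis using T.fil_mono by blast
  qed
  have "\<exists>k. (\<exists>s\<in>S. k s \<noteq> 0) \<and> (\<Sum>s\<in>S. \<kappa> (k s) * Z s) \<in> q"
    using card_less Z_fil
    by (intro T.ex_relation_in_fil[OF relation]) (auto simp: S_def K_def power_add)
  then obtain k s0 where s0: "s0 \<in> S" "k s0 \<noteq> 0" and sum: "(\<Sum>s\<in>S. \<kappa> (k s) * Z s) \<in> q" by blast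

  define M where "M = d * m * E + E * (r * m)"
  have Z_eq: "Z (\<nu>, \<mu>) = c ^ M * ([:radix m y' z d \<mu>:] * radix m \<omega> [:z:] r \<nu>)"
    if "\<nu> < m ^ r" "\<mu> < m ^ d" for \<nu> \<mu>
  proof -
    have "subst \<kappa> B (radix m y' z d \<mu>) = c ^ (d * m * E) * [:radix m y' z d \<mu>:]"
      using that hom_y hom_z by (intro B_hom radix_homogeneous) auto
    moreover have "radix m (\<lambda>i. \<Sum>k\<in>UNIV. subst \<kappa> B (w' (r - 1 - i) k) * u k) (subst \<kappa> B z) r \<nu>
        = radix m (\<lambda>i. c ^ E * \<omega> i) (c ^ E * [:z:]) r \<nu>"
    proof -
      have "(\<Sum>k\<in>UNIV. subst \<kappa> B (w' (r - 1 - i) k) * u k) = c ^ E * \<omega> i" if "i < r" for i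
      proof -
        have "homogeneous E (w' (r - 1 - i) k)" for k using that by (intro hom_w) auto
        then show ?thesis by (simp only: B_hom[of E] \<omega>_def sum_distrib_left mult.assoc)
      qed
      then have "radix m (\<lambda>i. \<Sum>k\<in>UNIV. subst \<kappa> B (w' (r - 1 - i) k) * u k) b r' \<nu>'
          = radix m (\<lambda>i. c ^ E * \<omega> i) b r' \<nu>'" if "r' \<le> r" for b r' \<nu>'
        using that by (induction r' arbitrary: \<nu>') auto
      then show ?thesis by (simp only: B_hom[OF hom_z] order_refl)
    qed
    ultimately show ?thesis
      by (simp only: Z_def prod.case radix_scale[OF that(1)] M_def power_add power_mult mult.assoc mult.left_commute)
  qed
  \<comment> \<open>Cancel \<open>c ^ M\<close>, separate the monomials in the \<open>\<omega> i\<close> by their degrees, and then use the independence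
    of the \<open>y' i\<close>.\<close>
  let ?f = "\<lambda>\<nu>. \<Sum>\<mu><m ^ d. Const (k (\<nu>, \<mu>)) * radix m y' z d \<mu>"
  have "(\<Sum>s\<in>S. \<kappa> (k s) * Z s) = (\<Sum>\<nu><m ^ r. \<Sum>\<mu><m ^ d. \<kappa> (k (\<nu>, \<mu>)) * Z (\<nu>, \<mu>))"
    by (simp add: S_def sum.cartesian_product)
  also have "\<dots> = (\<Sum>\<nu><m ^ r. \<Sum>\<mu><m ^ d. c ^ M * ([:Const (k (\<nu>, \<mu>)) * radix m y' z d \<mu>:] * radix m \<omega> [:z:] r \<nu>))"
    by (intro sum.cong refl) (simp add: Z_eq \<kappa>_def mult.left_commute mult.commute[of "radix m y' z d _"])
  also have "\<dots> = c ^ M * (\<Sum>\<nu><m ^ r. [:?f \<nu>:] * radix m \<omega> [:z:] r \<nu>)"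
    by (simp only: ring_map_sum[OF ring_map_pConst] sum_distrib_left sum_distrib_right)
  finally have "(\<Sum>\<nu><m ^ r. [:?f \<nu>:] * radix m \<omega> [:z:] r \<nu>) \<in> q"
    using sum c is_prime_power[OF q, of c M] by (auto simp: is_primeD(3)[OF q])
  then have "\<forall>\<nu>\<in>{..<m ^ r}. ?f \<nu> \<in> ?p"
    unfolding q_def
    by (rule coeffs_in_prime_if_distinct_leads[OF p finite_lessThan, rotated])
      (auto intro!: radix_lead_at[OF p] lead lead_at_const[OF Ip] zP)
  then have "\<forall>\<mu><m ^ d. k (\<nu>, \<mu>) = 0" if "\<nu> < m ^ r" for \<nu>
    using that P(1) chain zP[of 0] y'P
    by (intro radix_independent[OF ring_map_Const, where P = P and z = z and w = y']) auto
  then show False using s0 by (auto simp: S_def)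
qed

theorem theorem1p1:
  fixes I :: "'n::finite sym_poly set" and r :: nat
  assumes "1 \<le> r" and "r \<le> CARD('n)"
    and "closed_subscheme_S r I"
    and "V_plus I \<inter> V_plus (S_ideal (r - 1)) = {}"
  shows "scheme_dim I \<le> ereal (real (CARD('n) - r))"
  unfolding scheme_dim_def krull_dim_def
proof (rule SUP_least)
  let ?T = "subtopology Proj_top (V_plus I)"
  fix d assume "d \<in> {n. \<exists>Z. (\<forall>i\<le>n. irreducible_closed ?T (Z i)) \<and> (\<forall>i<n. Z i \<subset> Z (Suc i))}"
  then obtain Z where Z: "\<And>i. i \<le> d \<Longrightarrow> irreducible_closed ?T (Z i)" "\<And>i. i < d \<Longrightarrow> Z i \<subset> Z (Suc i)"
    by blast
  have sub: "Z i \<subseteq> Proj_points" if "i \<le> d" for i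
    using Z(1)[OF that] closedin_subset[of ?T "Z i"] by (auto simp: irreducible_closed_def topspace_Proj_top)
  have "d + r \<le> CARD('n)"
  proof (rule chain_length_le[of r I d "\<lambda>i. \<Inter>(Z i)"])
    show "\<Inter>(Z (Suc i)) \<subset> \<Inter>(Z i)" if "i < d" for i
      using Inter_psubset[OF Z(1) Z(2) sub] that by simp
  qed (use assms irreducible_closed_prime[OF Z(1)] in \<open>auto simp: closed_subscheme_S_def\<close>)
  then show "ereal (real d) \<le> ereal (real (CARD('n) - r))" by simp
qed

end
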